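(* Let $m\in\mathbb{N}$, let $E_1,\ldots,E_m$ be Riesz spaces, let $F$ be an Archimedean Riesz space and let $A\colon E_1\times\cdots\times E_m\longrightarrow F$ be a finite rank Riesz multimorphism. Then all the Arens extensions $AR_m^\rho(A)\colon E_1^{\sim\sim}\times\cdots\times E_m^{\sim\sim}\longrightarrow F^{\sim\sim}$, $\rho\in S_m$, coincide, and they are Riesz multimorphisms.
   Context: All Riesz spaces are real. $E^\sim$ is the order dual of a Riesz space $E$ (the order bounded, equivalently regular, linear functionals) and $E^{\sim\sim}=(E^\sim)^\sim$. $S_m$ is the set of permutations of $\{1,\ldots,m\}$. An $m$-linear operator $A\colon E_1\times\cdots\times E_m\to F$ between Riesz spaces is positive if $A(x_1,\ldots,x_m)\ge 0$ whenever all $x_i\ge 0$, and regular if it is a difference of two positive $m$-linear operators; $\mathcal{L}_r(E_1,\ldots,E_m;F)$ is the space of regular $m$-linear operators. A Riesz multimorphism is an $A\in\mathcal{L}_r(E_1,\ldots,E_m;F)$ with $|A(x_1,\ldots,x_m)|=A(|x_1|,\ldots,|x_m|)$ for all $x_i\in E_i$. A map taking values in a Riesz space has finite rank if the sublattice (Riesz subspace) generated by its range is finite dimensional. Arens extensions: fix $\rho\in S_m$. For $0\le k\le m$ let $I_k=\{1,\ldots,m\}\setminus\{\rho(1),\ldots,\rho(k)\}$ and let $\mathcal{L}^{\rho,k}$ be the space of regular $(m-k)$-linear forms on the product of the spaces $E_i$, $i\in I_k$ (in increasing order of indices), with $\mathcal{L}^{\rho,m}=\mathbb{R}$. For $1\le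 k\le m$ and $x''\in E_{\rho(k)}^{\sim\sim}$ define $\overline{x''}^{\rho}\colon\mathcal{L}^{\rho,k-1}\to\mathcal{L}^{\rho,k}$ by letting $\overline{x''}^{\rho}(B)\big((x_i)_{i\in I_k}\big)$ be the value of $x''$ at the functional $x_{\rho(k)}\mapsto B\big((x_i)_{i\in I_{k-1}}\big)$ in $E_{\rho(k)}^\sim$. For $A\in\mathcal{L}_r(E_1,\ldots,E_m;F)$ the Arens extension $AR_m^\rho(A)\colon E_1^{\sim\sim}\times\cdots\times E_m^{\sim\sim}\to F^{\sim\sim}$ is $$AR_m^\rho(A)(x_1'',\ldots,x_m'')(y')=\big(\overline{x_{\rho(m)}''}^{\rho}\circ\cdots\circ\overline{x_{\rho(1)}''}^{\rho}\big)(y'\circ A),\quad y'\in F^\sim.$$ *)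

theory Defs
  imports Complex_Main "HOL-Algebra.Group" "HOL-Combinatorics.Permutations"
begin

section \<open>Riesz spaces\<close>

text \<open>
  Riesz spaces are structures with an explicit carrier, so that the members of a finite family
  \<open>E 1, \<dots>, E m\<close> may be different spaces and so that the order dual, which lives on a set of
  functions, is again a structure of the same kind. Order, joins and meets are those of
  HOL-Algebra (the locale \<^locale>\<open>lattice\<close> forces the equivalence \<open>eq\<close> to be equality).
\<close>

record 'a riesz = "'a gorder" +
  vadd :: "'a \<Rightarrow> 'a \<Rightarrow> 'a"  (infixl \<open>\<boxplus>\<index>\<close> 65)
  vzero :: 'a  (\<open>\<Zero>\<index>\<close>)
  vscale :: "real \<Rightarrow> 'a \<Rightarrow> 'a"  (infixr \<open>\<bullet>\<index>\<close> 70)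

locale riesz_space = lattice E for E (structure) +
  assumes add_group: "comm_group \<lparr>carrier = carrier E, monoid.mult = vadd E, one = vzero E\<rparr>"
    and scale_closed: "x \<in> carrier E \<Longrightarrow> a \<bullet> x \<in> carrier E"
    and scale_add_right: "\<lbrakk>x \<in> carrier E; y \<in> carrier E\<rbrakk> \<Longrightarrow> a \<bullet> (x \<boxplus> y) = a \<bullet> x \<boxplus> a \<bullet> y"
    and scale_add_left: "x \<in> carrier E \<Longrightarrow> (a + b) \<bullet> x = a \<bullet> x \<boxplus> b \<bullet> x"
    and scale_scale: "x \<in> carrier E \<Longrightarrow> a \<bullet> (b \<bullet> x) = (a * b) \<bullet> x"
    and scale_one: "x \<in> carrier E \<Longrightarrow> 1 \<bullet> x = x"
    and add_mono: "\<lbrakk>x \<in> carrier E; y \<in> carrier E; z \<in> carrier E; x \<sqsubseteq> y\<rbrakk> \<Longrightarrow> x \<boxplus> z \<sqsubseteq> y \<boxplus> z"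
    and scale_nonneg: "\<lbrakk>x \<in> carrier E; \<Zero> \<sqsubseteq> x; 0 \<le> a\<rbrakk> \<Longrightarrow> \<Zero> \<sqsubseteq> a \<bullet> x"

definition vabs :: "('a, 'c) riesz_scheme \<Rightarrow> 'a \<Rightarrow> 'a" where
  "vabs E x = x \<squnion>\<^bsub>E\<^esub> ((-1) \<bullet>\<^bsub>E\<^esub> x)"

definition archimedean :: "('a, 'c) riesz_scheme \<Rightarrow> bool" where
  "archimedean E \<longleftrightarrow>
    (\<forall>x\<in>carrier E. \<forall>y\<in>carrier E.
      \<Zero>\<^bsub>E\<^esub> \<sqsubseteq>\<^bsub>E\<^esub> x \<and> (\<forall>n::nat. real n \<bullet>\<^bsub>E\<^esub> x \<sqsubseteq>\<^bsub>E\<^esub> y) \<longrightarrow> x = \<Zero>\<^bsub>E\<^esub>)"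

definition linear_subspace :: "('a, 'c) riesz_scheme \<Rightarrow> 'a set \<Rightarrow> bool" where
  "linear_subspace E S \<longleftrightarrow>
    S \<subseteq> carrier E \<and> \<Zero>\<^bsub>E\<^esub> \<in> S \<and>
    (\<forall>x\<in>S. \<forall>y\<in>S. x \<boxplus>\<^bsub>E\<^esub> y \<in> S) \<and> (\<forall>a. \<forall>x\<in>S. a \<bullet>\<^bsub>E\<^esub> x \<in> S)"

definition riesz_subspace :: "('a, 'c) riesz_scheme \<Rightarrow> 'a set \<Rightarrow> bool" where
  "riesz_subspace E S \<longleftrightarrow>
    linear_subspace E S \<and> (\<forall>x\<in>S. \<forall>y\<in>S. x \<squnion>\<^bsub>E\<^esub> y \<in> S \<and> x \<sqinter>\<^bsub>E\<^esub> y \<in> S)"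

text \<open>For a linear subspace \<open>S\<close>; \<open>linear_subspace E hull B\<close> is the linear span of \<open>B\<close>.\<close>

definition finite_dimensional :: "('a, 'c) riesz_scheme \<Rightarrow> 'a set \<Rightarrow> bool" where
  "finite_dimensional E S \<longleftrightarrow> (\<exists>B. finite B \<and> B \<subseteq> S \<and> linear_subspace E hull B = S)"

section \<open>The order dual\<close>

definition order_bounded_functional :: "('a, 'c) riesz_scheme \<Rightarrow> ('a \<Rightarrow> real) \<Rightarrow> bool" where
  "order_bounded_functional E f \<longleftrightarrow>
    (\<forall>x\<in>carrier E. \<forall>y\<in>carrier E. f (x \<boxplus>\<^bsub>E\<^esub> y) = f x + f y) \<and>
    (\<forall>a. \<forall>x\<in>carrier E. f (a \<bullet>\<^bsub>E\<^esub> x) = a * f x) \<and>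
    (\<forall>u\<in>carrier E. \<forall>v\<in>carrier E. \<exists>M. \<forall>x\<in>\<lbrace>u..v\<rbrace>\<^bsub>E\<^esub>. \<bar>f x\<bar> \<le> M)"

text \<open>
  Functionals on \<open>carrier E\<close> are represented by functions that are \<open>undefined\<close> outside
  \<open>carrier E\<close>, so that equality in the dual is equality on \<open>carrier E\<close>.
\<close>

definition order_dual :: "('a, 'c) riesz_scheme \<Rightarrow> ('a \<Rightarrow> real) riesz" where
  "order_dual E =
    \<lparr>carrier = {f \<in> extensional (carrier E). order_bounded_functional E f},
     eq = (=),
     le = (\<lambda>f g. \<forall>x\<in>carrier E. \<Zero>\<^bsub>E\<^esub> \<sqsubseteq>\<^bsub>E\<^esub> x \<longrightarrow> f x \<le> g x),
     vadd = (\<lambda>f g. \<lambda>x\<in>carrier E. f x + g x),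
     vzero = (\<lambda>x\<in>carrier E. 0),
     vscale = (\<lambda>a f. \<lambda>x\<in>carrier E. a * f x)\<rparr>"

abbreviation order_bidual :: "('a, 'c) riesz_scheme \<Rightarrow> (('a \<Rightarrow> real) \<Rightarrow> real) riesz" where
  "order_bidual E \<equiv> order_dual (order_dual E)"

section \<open>Multilinear operators\<close>

text \<open>
  Operators on the product of the spaces \<open>E i\<close>, \<open>i \<in> I\<close>; a point of the product is a function in
  \<open>Pi\<^sub>E I (\<lambda>i. carrier (E i))\<close>. Only values on the product matter.
\<close>

abbreviation points :: "nat set \<Rightarrow> (nat \<Rightarrow> ('a, 'c) riesz_scheme) \<Rightarrow> (nat \<Rightarrow> 'a) set" where
  "points I E \<equiv> Pi\<^sub>E I (\<lambda>i. carrier (E i))"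

definition multilinear ::
  "nat set \<Rightarrow> (nat \<Rightarrow> 'a riesz) \<Rightarrow> 'b riesz \<Rightarrow> ((nat \<Rightarrow> 'a) \<Rightarrow> 'b) \<Rightarrow> bool" where
  "multilinear I E F A \<longleftrightarrow>
    A \<in> points I E \<rightarrow> carrier F \<and>
    (\<forall>x\<in>points I E. \<forall>i\<in>I. \<forall>u\<in>carrier (E i). \<forall>v\<in>carrier (E i).
      A (x(i := u \<boxplus>\<^bsub>E i\<^esub> v)) = A (x(i := u)) \<boxplus>\<^bsub>F\<^esub> A (x(i := v))) \<and>
    (\<forall>x\<in>points I E. \<forall>i\<in>I. \<forall>a. \<forall>u\<in>carrier (E i).
      A (x(i := a \<bullet>\<^bsub>E i\<^esub> u)) = a \<bullet>\<^bsub>F\<^esub> A (x(i := u)))"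

definition positive_multilinear ::
  "nat set \<Rightarrow> (nat \<Rightarrow> 'a riesz) \<Rightarrow> 'b riesz \<Rightarrow> ((nat \<Rightarrow> 'a) \<Rightarrow> 'b) \<Rightarrow> bool" where
  "positive_multilinear I E F A \<longleftrightarrow>
    multilinear I E F A \<and>
    (\<forall>x\<in>points I E. (\<forall>i\<in>I. \<Zero>\<^bsub>E i\<^esub> \<sqsubseteq>\<^bsub>E i\<^esub> x i) \<longrightarrow> \<Zero>\<^bsub>F\<^esub> \<sqsubseteq>\<^bsub>F\<^esub> A x)"

definition regular_multilinear ::
  "nat set \<Rightarrow> (nat \<Rightarrow> 'a riesz) \<Rightarrow> 'b riesz \<Rightarrow> ((nat \<Rightarrow> 'a) \<Rightarrow> 'b) \<Rightarrow> bool" where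
  "regular_multilinear I E F A \<longleftrightarrow>
    multilinear I E F A \<and>
    (\<exists>P Q. positive_multilinear I E F P \<and> positive_multilinear I E F Q \<and>
      (\<forall>x\<in>points I E. A x = P x \<boxplus>\<^bsub>F\<^esub> (-1) \<bullet>\<^bsub>F\<^esub> Q x))"

definition riesz_multimorphism ::
  "nat set \<Rightarrow> (nat \<Rightarrow> 'a riesz) \<Rightarrow> 'b riesz \<Rightarrow> ((nat \<Rightarrow> 'a) \<Rightarrow> 'b) \<Rightarrow> bool" where
  "riesz_multimorphism I E F A \<longleftrightarrow>
    regular_multilinear I E F A \<and>
    (\<forall>x\<in>points I E. vabs F (A x) = A (\<lambda>i\<in>I. vabs (E i) (x i)))"

definition finite_rank ::
  "nat set \<Rightarrow> (nat \<Rightarrow> 'a riesz) \<Rightarrow> 'b riesz \<Rightarrow> ((nat \<Rightarrow> 'a) \<Rightarrow> 'b) \<Rightarrow> bool" where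
  "finite_rank I E F A \<longleftrightarrow> finite_dimensional F (riesz_subspace F hull (A ` points I E))"

section \<open>Arens extensions\<close>

text \<open>
  For a form \<open>B\<close> on the product over \<open>I\<close>, \<open>j \<in> I\<close> and \<open>z\<close> in the order bidual of \<open>E j\<close>: the form
  on the product over \<open>I - {j}\<close> obtained by applying \<open>z\<close> to \<open>B\<close> as a functional of its
  \<open>j\<close>-th argument. As arguments are indexed families, no reordering of indices is needed.
\<close>

definition arens_step ::
  "(nat \<Rightarrow> 'a riesz) \<Rightarrow> nat set \<Rightarrow> nat \<Rightarrow> (('a \<Rightarrow> real) \<Rightarrow> real) \<Rightarrow>
    ((nat \<Rightarrow> 'a) \<Rightarrow> real) \<Rightarrow> ((nat \<Rightarrow> 'a) \<Rightarrow> real)" where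
  "arens_step E I j z B = (\<lambda>x\<in>points (I - {j}) E. z (\<lambda>t\<in>carrier (E j). B (x(j := t))))"

text \<open>
  \<open>arens_iter E m \<rho> z k B\<close> has consumed the arguments \<open>\<rho> 1, \<dots>, \<rho> k\<close>, in this order.
\<close>

primrec arens_iter ::
  "(nat \<Rightarrow> 'a riesz) \<Rightarrow> nat \<Rightarrow> (nat \<Rightarrow> nat) \<Rightarrow> (nat \<Rightarrow> ('a \<Rightarrow> real) \<Rightarrow> real) \<Rightarrow> nat \<Rightarrow>
    ((nat \<Rightarrow> 'a) \<Rightarrow> real) \<Rightarrow> ((nat \<Rightarrow> 'a) \<Rightarrow> real)" where
  "arens_iter E m \<rho> z 0 B = B"
| "arens_iter E m \<rho> z (Suc k) B =
    arens_step E ({1..m} - \<rho> ` {1..k}) (\<rho> (Suc k)) (z (\<rho> (Suc k))) (arens_iter E m \<rho> z k B)"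

text \<open>
  After \<open>m\<close> steps a form on the empty product is left, which is identified with its value at the
  only point \<open>\<lambda>_. undefined\<close> of that product.
\<close>

definition arens_extension ::
  "(nat \<Rightarrow> 'a riesz) \<Rightarrow> 'b riesz \<Rightarrow> nat \<Rightarrow> (nat \<Rightarrow> nat) \<Rightarrow> ((nat \<Rightarrow> 'a) \<Rightarrow> 'b) \<Rightarrow>
    (nat \<Rightarrow> ('a \<Rightarrow> real) \<Rightarrow> real) \<Rightarrow> (('b \<Rightarrow> real) \<Rightarrow> real)" where
  "arens_extension E F m \<rho> A =
    (\<lambda>z\<in>points {1..m} (\<lambda>i. order_bidual (E i)).
      \<lambda>f\<in>carrier (order_dual F).
        arens_iter E m \<rho> z m (\<lambda>x\<in>points {1..m} E. f (A x)) (\<lambda>_. undefined))"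

end

theory Submission
  imports Defs "HOL-Algebra.FiniteProduct"
begin

text \<open>
  The Riesz subspace generated by the range of \<open>A\<close> is finite-dimensional and Archimedean, so it has
  a basis of pairwise disjoint positive vectors \<open>u\<close>. The coordinates of \<open>A\<close> in this basis are
  real-valued Riesz multimorphisms, and these are products of one-variable Riesz functionals:
  \<open>A x = (\<Sum>u. \<kappa> u * (\<Prod>i. h u i (x i)) \<bullet> u)\<close>. Each step of the Arens construction
  replaces a factor \<open>h u i (x i)\<close> by \<open>z i (h u i)\<close>, so that in any order one arrives at
  the evaluation at \<open>\<Sum>u. \<kappa> u * (\<Prod>i. z i (h u i)) \<bullet> u\<close>. This is a Riesz
  multimorphism in \<open>z\<close>: evaluation \<open>F \<rightarrow> F\<^sup>\<sim>\<^sup>\<sim>\<close> preserves absolute values, absolute values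
  of disjoint sums are taken coordinatewise, and \<open>\<bar>z\<bar> h = \<bar>z h\<bar>\<close> for a Riesz functional \<open>h\<close>,
  because \<open>[0, h]\<close> consists of multiples of \<open>h\<close>.
\<close>

section \<open>Riesz spaces\<close>

text \<open>For a general regular operator the Arens extensions depend on the order in which the
  arguments are consumed. For a finite sum of products of one-variable functionals they cannot,
  since each bidual element meets only its own factor; this is why a product formula is the goal.

  The Archimedean property is what makes disjoint systems span. The lexicographic plane has
  dimension two, but being totally ordered it has no two disjoint nonzero positive vectors.

  The constants \<open>\<kappa> u\<close> are kept apart from the factors because for
  \<open>m = 0\<close> there is no factor to absorb them.

  The order dual of an Archimedean space may be too small to separate points, and may even be zero,
  so \<open>evaluation\<close> need not be injective. That it preserves absolute values is obtained
  by splitting a positive functional into two components, one for each sign of the vector.\<close>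

context riesz_space
begin

lemma zero_closed [simp]: "\<Zero> \<in> carrier E"
  using add_group by (auto simp: comm_group_def comm_monoid_def monoid_def)

lemma add_closed [simp]: "x \<in> carrier E \<Longrightarrow> y \<in> carrier E \<Longrightarrow> x \<boxplus> y \<in> carrier E"
  using monoid.m_closed[of "\<lparr>carrier = carrier E, monoid.mult = vadd E, one = vzero E\<rparr>"] add_group
  by (simp add: comm_group_def comm_monoid_def)

declare scale_closed [simp]

lemma add_comm: "x \<in> carrier E \<Longrightarrow> y \<in> carrier E \<Longrightarrow> x \<boxplus> y = y \<boxplus> x"
  using comm_monoid.m_comm[of "\<lparr>carrier = carrier E, monoid.mult = vadd E, one = vzero E\<rparr>"] add_group
  by (simp add: comm_group_def)

lemma add_assoc:
  "x \<in> carrier E \<Longrightarrow> y \<in> carrier E \<Longrightarrow> z \<in> carrier E \<Longrightarrow> (x \<boxplus> y) \<boxplus> z = x \<boxplus> (y \<boxplus> z)"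
  using monoid.m_assoc[of "\<lparr>carrier = carrier E, monoid.mult = vadd E, one = vzero E\<rparr>"] add_group
  by (simp add: comm_group_def comm_monoid_def)

lemma add_zero [simp]: "x \<in> carrier E \<Longrightarrow> x \<boxplus> \<Zero> = x"
  using monoid.r_one[of "\<lparr>carrier = carrier E, monoid.mult = vadd E, one = vzero E\<rparr>"] add_group
  by (simp add: comm_group_def comm_monoid_def)

lemma zero_add [simp]: "x \<in> carrier E \<Longrightarrow> \<Zero> \<boxplus> x = x"
  by (simp add: add_comm)

lemma add_cancel:
  "x \<in> carrier E \<Longrightarrow> y \<in> carrier E \<Longrightarrow> z \<in> carrier E \<Longrightarrow> x \<boxplus> y = x \<boxplus> z \<longleftrightarrow> y = z"
  using monoid.Units_l_cancel[of "\<lparr>carrier = carrier E, monoid.mult = vadd E, one = vzero E\<rparr>" x y z]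
    group.Units_eq[of "\<lparr>carrier = carrier E, monoid.mult = vadd E, one = vzero E\<rparr>"] add_group
  by (auto simp: comm_group_def group_def)

lemma scale_0_left [simp]: "x \<in> carrier E \<Longrightarrow> 0 \<bullet> x = \<Zero>"
  using scale_add_left[of x 0 0] add_cancel[of "0 \<bullet> x" "0 \<bullet> x" \<Zero>] by simp

lemma scale_zero [simp]: "a \<bullet> \<Zero> = \<Zero>"
  using scale_scale[of \<Zero> a 0] by simp

lemma add_interchange:
  assumes "x \<in> carrier E" "y \<in> carrier E" "z \<in> carrier E" "w \<in> carrier E"
  shows "(x \<boxplus> y) \<boxplus> (z \<boxplus> w) = (x \<boxplus> z) \<boxplus> (y \<boxplus> w)"
  using assms by (metis add_assoc add_closed add_comm)

text \<open>
  Linear identities between a few vectors are decided by comparing coefficients: after the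
  following rules, the simplifier rewrites both sides to the form \<open>L a b c d\<close>.
\<close>

lemma lin4:
  assumes c: "x \<in> carrier E" "y \<in> carrier E" "z \<in> carrier E" "w \<in> carrier E"
    and L: "\<And>L. \<lbrakk>x = L 1 0 0 0; y = L 0 1 0 0; z = L 0 0 1 0; w = L 0 0 0 1; \<Zero> = L 0 0 0 0;
      \<And>a b c d a' b' c' d'. L a b c d \<boxplus> L a' b' c' d' = L (a + a') (b + b') (c + c') (d + d');
      \<And>k a b c d. k \<bullet> L a b c d = L (k * a) (k * b) (k * c) (k * d)\<rbrakk> \<Longrightarrow> P"
  shows P
proof (rule L[of "\<lambda>a b c d. (a \<bullet> x \<boxplus> b \<bullet> y) \<boxplus> (c \<bullet> z \<boxplus> d \<bullet> w)"])
  fix a b c d a' b' c' d'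
  show "((a \<bullet> x \<boxplus> b \<bullet> y) \<boxplus> (c \<bullet> z \<boxplus> d \<bullet> w)) \<boxplus> ((a' \<bullet> x \<boxplus> b' \<bullet> y) \<boxplus> (c' \<bullet> z \<boxplus> d' \<bullet> w))
    = ((a + a') \<bullet> x \<boxplus> (b + b') \<bullet> y) \<boxplus> ((c + c') \<bullet> z \<boxplus> (d + d') \<bullet> w)"
    using c by (simp add: scale_add_left add_interchange[of "a \<bullet> x \<boxplus> b \<bullet> y"]
        add_interchange[of "a \<bullet> x"] add_interchange[of "c \<bullet> z"])
qed (use c in \<open>simp_all add: scale_one scale_add_right scale_scale\<close>)

lemma lin3:
  assumes c: "x \<in> carrier E" "y \<in> carrier E" "z \<in> carrier E"
    and L: "\<And>L. \<lbrakk>x = L 1 0 0; y = L 0 1 0; z = L 0 0 1; \<Zero> = L 0 0 0;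
      \<And>a b c a' b' c'. L a b c \<boxplus> L a' b' c' = L (a + a') (b + b') (c + c');
      \<And>k a b c. k \<bullet> L a b c = L (k * a) (k * b) (k * c)\<rbrakk> \<Longrightarrow> P"
  shows P
proof (rule lin4[OF c zero_closed])
  fix L :: "real \<Rightarrow> real \<Rightarrow> real \<Rightarrow> real \<Rightarrow> 'a"
  assume L4: "x = L 1 0 0 0" "y = L 0 1 0 0" "z = L 0 0 1 0" "\<Zero> = L 0 0 0 0"
    "\<And>a b c d a' b' c' d'. L a b c d \<boxplus> L a' b' c' d' = L (a + a') (b + b') (c + c') (d + d')"
    "\<And>k a b c d. k \<bullet> L a b c d = L (k * a) (k * b) (k * c) (k * d)"
  show P
    by (rule L[of "\<lambda>a b c. L a b c 0"]) (simp_all only: L4 add_0_right mult_zero_right)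
qed

lemma lin2:
  assumes c: "x \<in> carrier E" "y \<in> carrier E"
    and L: "\<And>L. \<lbrakk>x = L 1 0; y = L 0 1; \<Zero> = L 0 0;
      \<And>a b a' b'. L a b \<boxplus> L a' b' = L (a + a') (b + b');
      \<And>k a b. k \<bullet> L a b = L (k * a) (k * b)\<rbrakk> \<Longrightarrow> P"
  shows P
proof (rule lin3[OF c zero_closed])
  fix L :: "real \<Rightarrow> real \<Rightarrow> real \<Rightarrow> 'a"
  assume L3: "x = L 1 0 0" "y = L 0 1 0" "\<Zero> = L 0 0 0"
    "\<And>a b c a' b' c'. L a b c \<boxplus> L a' b' c' = L (a + a') (b + b') (c + c')"
    "\<And>k a b c. k \<bullet> L a b c = L (k * a) (k * b) (k * c)"
  show P
    by (rule L[of "\<lambda>a b. L a b 0"]) (simp_all only: L3 add_0_right mult_zero_right)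
qed

lemma lin1:
  assumes c: "x \<in> carrier E"
    and L: "\<And>L. \<lbrakk>x = L 1; \<Zero> = L 0; \<And>a a'. L a \<boxplus> L a' = L (a + a');
      \<And>k a. k \<bullet> L a = L (k * a)\<rbrakk> \<Longrightarrow> P"
  shows P
  by (rule L[of "\<lambda>a. a \<bullet> x"]) (use c in \<open>simp_all add: scale_one scale_add_left scale_scale\<close>)

section \<open>Compatibility of the order with linear combinations\<close>

lemma le_iff_diff:
  assumes "x \<in> carrier E" "y \<in> carrier E"
  shows "x \<sqsubseteq> y \<longleftrightarrow> \<Zero> \<sqsubseteq> y \<boxplus> (-1) \<bullet> x"
proof
  assume "x \<sqsubseteq> y"
  moreover have "x \<boxplus> (-1) \<bullet> x = \<Zero>"
    by (rule lin2[OF assms]) simp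
  ultimately show "\<Zero> \<sqsubseteq> y \<boxplus> (-1) \<bullet> x"
    using add_mono[of x y "(-1) \<bullet> x"] assms scale_closed by metis
next
  assume "\<Zero> \<sqsubseteq> y \<boxplus> (-1) \<bullet> x"
  moreover have "(y \<boxplus> (-1) \<bullet> x) \<boxplus> x = y"
    by (rule lin2[OF assms]) simp
  ultimately show "x \<sqsubseteq> y"
    using add_mono[of \<Zero> "y \<boxplus> (-1) \<bullet> x" x] assms by (metis add_closed scale_closed zero_add zero_closed)
qed

lemma add_nonneg:
  assumes "x \<in> carrier E" "y \<in> carrier E" "\<Zero> \<sqsubseteq> x" "\<Zero> \<sqsubseteq> y"
  shows "\<Zero> \<sqsubseteq> x \<boxplus> y"
  using add_mono[of \<Zero> x y] le_trans[of \<Zero> y "x \<boxplus> y"] assms by simp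

text \<open>Certificate form for inequalities: once the slack of the goal is a nonnegative
  combination of two known slacks, only a vector identity is left, and the \<open>lin\<close> rules
  settle it by comparing coefficients. The numbers supplied for \<open>s\<close> and
  \<open>t\<close> in later proofs are these multipliers.\<close>

lemma le_combination:
  assumes "a \<sqsubseteq> b" "a' \<sqsubseteq> b'" "0 \<le> s" "0 \<le> t"
    and c: "a \<in> carrier E" "b \<in> carrier E" "a' \<in> carrier E" "b' \<in> carrier E"
      "x \<in> carrier E" "y \<in> carrier E"
    and eq: "y \<boxplus> (-1) \<bullet> x = s \<bullet> (b \<boxplus> (-1) \<bullet> a) \<boxplus> t \<bullet> (b' \<boxplus> (-1) \<bullet> a')"
  shows "x \<sqsubseteq> y"
  unfolding le_iff_diff[OF c(5,6)] eq
  using assms le_iff_diff[of a b] le_iff_diff[of a' b'] by (simp add: add_nonneg scale_nonneg)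

lemma le_scaled:
  assumes "a \<sqsubseteq> b" "0 \<le> s"
    and c: "a \<in> carrier E" "b \<in> carrier E" "x \<in> carrier E" "y \<in> carrier E"
    and eq: "y \<boxplus> (-1) \<bullet> x = s \<bullet> (b \<boxplus> (-1) \<bullet> a)"
  shows "x \<sqsubseteq> y"
  unfolding le_iff_diff[OF c(3,4)] eq
  using assms le_iff_diff[of a b] by (simp add: scale_nonneg)

lemma le_antisym:
  "x \<sqsubseteq> y \<Longrightarrow> y \<sqsubseteq> x \<Longrightarrow> x \<in> carrier E \<Longrightarrow> y \<in> carrier E \<Longrightarrow> x = y"
  using weak_le_antisym eq_is_equal by simp

lemma scale_mono:
  assumes "x \<sqsubseteq> y" "0 \<le> a" "x \<in> carrier E" "y \<in> carrier E"
  shows "a \<bullet> x \<sqsubseteq> a \<bullet> y"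
  by (rule le_scaled[OF assms(1,2)], use assms in simp_all)
    (rule lin2[of x y], use assms in simp_all)

lemma scale_left_mono:
  assumes "a \<le> b" "\<Zero> \<sqsubseteq> x" "x \<in> carrier E"
  shows "a \<bullet> x \<sqsubseteq> b \<bullet> x"
  by (rule le_scaled[of \<Zero> x "b - a"], use assms in simp_all)
    (rule lin1[of x], use assms in simp_all)

lemma add_le_add:
  assumes "x \<sqsubseteq> y" "z \<sqsubseteq> w" "x \<in> carrier E" "y \<in> carrier E" "z \<in> carrier E" "w \<in> carrier E"
  shows "x \<boxplus> z \<sqsubseteq> y \<boxplus> w"
  by (rule le_combination[of x y z w 1 1], use assms in simp_all)
    (rule lin4[of x y z w], use assms in simp_all)

lemma le_add_right:
  assumes "\<Zero> \<sqsubseteq> y" "x \<in> carrier E" "y \<in> carrier E"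
  shows "x \<sqsubseteq> x \<boxplus> y"
  using add_le_add[of x x \<Zero> y] assms by simp

section \<open>Absolute values and positive parts\<close>

lemma vabs_closed [simp]: "x \<in> carrier E \<Longrightarrow> vabs E x \<in> carrier E"
  by (simp add: vabs_def)

lemma vabs_ge: "x \<in> carrier E \<Longrightarrow> x \<sqsubseteq> vabs E x"
  by (simp add: vabs_def join_left)

lemma vabs_ge_neg: "x \<in> carrier E \<Longrightarrow> (-1) \<bullet> x \<sqsubseteq> vabs E x"
  by (simp add: vabs_def join_right)

lemma vabs_least:
  "x \<sqsubseteq> y \<Longrightarrow> (-1) \<bullet> x \<sqsubseteq> y \<Longrightarrow> x \<in> carrier E \<Longrightarrow> y \<in> carrier E \<Longrightarrow> vabs E x \<sqsubseteq> y"
  by (simp add: vabs_def join_le)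

text \<open>Average \<open>vabs_ge\<close> and \<open>vabs_ge_neg\<close>: the multiples of
  \<open>x\<close> cancel.\<close>

lemma vabs_nonneg [simp]:
  assumes "x \<in> carrier E"
  shows "\<Zero> \<sqsubseteq> vabs E x"
  by (rule le_combination[OF vabs_ge[OF assms] vabs_ge_neg[OF assms], of "1/2" "1/2"], use assms in simp_all)
    (rule lin2[of x "vabs E x"], use assms in simp_all)

lemma vabs_eqI:
  assumes "x \<sqsubseteq> y" "(-1) \<bullet> x \<sqsubseteq> y" "x \<in> carrier E" "y \<in> carrier E"
    and "\<And>z. z \<in> carrier E \<Longrightarrow> x \<sqsubseteq> z \<Longrightarrow> (-1) \<bullet> x \<sqsubseteq> z \<Longrightarrow> y \<sqsubseteq> z"
  shows "vabs E x = y"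
  using assms by (intro le_antisym vabs_least) (auto simp: vabs_ge vabs_ge_neg)

lemma vabs_of_nonneg:
  assumes "\<Zero> \<sqsubseteq> x" "x \<in> carrier E"
  shows "vabs E x = x"
proof (rule vabs_eqI)
  show "(-1) \<bullet> x \<sqsubseteq> x"
    by (rule le_scaled[OF assms(1), of 2]) (use assms in simp_all,
      rule lin1[of x], use assms in simp_all)
qed (use assms in simp_all)

lemma neg_neg: "x \<in> carrier E \<Longrightarrow> (-1) \<bullet> (-1) \<bullet> x = x"
  by (simp add: scale_scale scale_one)

lemma vabs_neg:
  assumes "x \<in> carrier E"
  shows "vabs E ((-1) \<bullet> x) = vabs E x"
  by (rule vabs_eqI) (use assms in \<open>auto simp: vabs_ge vabs_ge_neg neg_neg intro: vabs_least\<close>)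

lemma vabs_scale_nonneg:
  assumes "\<Zero> \<sqsubseteq> x" "x \<in> carrier E"
  shows "vabs E (a \<bullet> x) = \<bar>a\<bar> \<bullet> x"
proof (cases "0 \<le> a")
  case True
  then show ?thesis using assms by (simp add: vabs_of_nonneg scale_nonneg)
next
  case False
  then have "vabs E ((-a) \<bullet> x) = \<bar>a\<bar> \<bullet> x"
    using assms by (simp add: vabs_of_nonneg scale_nonneg)
  moreover have "(-1) \<bullet> (a \<bullet> x) = (-a) \<bullet> x"
    using assms by (simp add: scale_scale)
  ultimately show ?thesis
    using vabs_neg[of "a \<bullet> x"] assms by simp
qed

lemma vabs_triangle:
  assumes "x \<in> carrier E" "y \<in> carrier E"
  shows "vabs E (x \<boxplus> y) \<sqsubseteq> vabs E x \<boxplus> vabs E y"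
proof (rule vabs_least)
  show "x \<boxplus> y \<sqsubseteq> vabs E x \<boxplus> vabs E y"
    using assms by (simp add: add_le_add vabs_ge)
  show "(-1) \<bullet> (x \<boxplus> y) \<sqsubseteq> vabs E x \<boxplus> vabs E y"
    using assms by (simp add: scale_add_right add_le_add vabs_ge_neg)
qed (use assms in simp_all)

text \<open>This is \<open>x \<squnion> \<Zero>\<close>, written through the absolute value: the
  positive parts of \<open>x\<close> and of its negative then share the vector
  \<open>vabs E x\<close>, and the relations between them become linear identities.\<close>

definition pos_part :: "'a \<Rightarrow> 'a" where
  "pos_part x = (1/2) \<bullet> (vabs E x \<boxplus> x)"

lemma pos_part_closed [simp]: "x \<in> carrier E \<Longrightarrow> pos_part x \<in> carrier E"
  by (simp add: pos_part_def)

lemma pos_part_nonneg [simp]: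
  assumes "x \<in> carrier E"
  shows "\<Zero> \<sqsubseteq> pos_part x"
  unfolding pos_part_def
  by (rule le_scaled[OF vabs_ge_neg[OF assms], of "1/2"], use assms in simp_all)
    (rule lin2[of x "vabs E x"], use assms in simp_all)

lemma pos_part_diff:
  assumes "x \<in> carrier E"
  shows "pos_part x \<boxplus> (-1) \<bullet> pos_part ((-1) \<bullet> x) = x"
  unfolding pos_part_def vabs_neg[OF assms]
  by (rule lin2[of x "vabs E x"], use assms in simp_all)

lemma pos_part_add:
  assumes "x \<in> carrier E"
  shows "pos_part x \<boxplus> pos_part ((-1) \<bullet> x) = vabs E x"
  unfolding pos_part_def vabs_neg[OF assms]
  by (rule lin2[of x "vabs E x"], use assms in simp_all)

lemma pos_part_ge:
  assumes "x \<in> carrier E"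
  shows "x \<sqsubseteq> pos_part x"
  unfolding pos_part_def
  by (rule le_scaled[OF vabs_ge[OF assms], of "1/2"], use assms in simp_all)
    (rule lin2[of x "vabs E x"], use assms in simp_all)

text \<open>The hypotheses make \<open>2y - x\<close> an upper bound of both \<open>x\<close> and
  \<open>-x\<close>, hence of the absolute value.\<close>

lemma pos_part_least:
  assumes "x \<sqsubseteq> y" "\<Zero> \<sqsubseteq> y" and c: "x \<in> carrier E" "y \<in> carrier E"
  shows "pos_part x \<sqsubseteq> y"
proof -
  have "vabs E x \<sqsubseteq> 2 \<bullet> y \<boxplus> (-1) \<bullet> x"
  proof (rule vabs_least)
    show "x \<sqsubseteq> 2 \<bullet> y \<boxplus> (-1) \<bullet> x"
      by (rule le_scaled[OF assms(1), of 2], use c in simp_all)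
        (rule lin2[of x y], use c in simp_all)
    show "(-1) \<bullet> x \<sqsubseteq> 2 \<bullet> y \<boxplus> (-1) \<bullet> x"
      by (rule le_scaled[OF assms(2), of 2], use c in simp_all)
        (rule lin2[of x y], use c in simp_all)
  qed (use c in simp_all)
  then show ?thesis
    unfolding pos_part_def
    by (rule le_scaled[of _ _ "1/2"], use c in simp_all)
      (rule lin3[of x "vabs E x" y], use c in simp_all)
qed

text \<open>For positive vectors this says that the meet is zero; for arbitrary ones it is
  \<open>x \<sqinter> y \<sqsubseteq> \<Zero>\<close>. Quantifying over lower bounds replaces
  computations with meets by linear inequalities.\<close>

definition disjoint_from :: "'a \<Rightarrow> 'a \<Rightarrow> bool" where
  "disjoint_from x y \<longleftrightarrow> (\<forall>z\<in>carrier E. z \<sqsubseteq> x \<longrightarrow> z \<sqsubseteq> y \<longrightarrow> z \<sqsubseteq> \<Zero>)"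

lemma disjoint_from_commute: "disjoint_from x y \<longleftrightarrow> disjoint_from y x"
  by (auto simp: disjoint_from_def)

lemma disjoint_from_mono:
  "\<lbrakk>disjoint_from x y; u \<sqsubseteq> x; v \<sqsubseteq> y; u \<in> carrier E; v \<in> carrier E; x \<in> carrier E; y \<in> carrier E\<rbrakk>
    \<Longrightarrow> disjoint_from u v"
  unfolding disjoint_from_def by (meson le_trans)

text \<open>A vector \<open>z\<close> below both parts can be subtracted twice from the absolute
  value, and the result still dominates \<open>x\<close> and its negative. Leastness of the absolute
  value then forces \<open>z \<sqsubseteq> \<Zero>\<close>.\<close>

lemma disjoint_pos_parts:
  assumes "x \<in> carrier E"
  shows "disjoint_from (pos_part x) (pos_part ((-1) \<bullet> x))"
  unfolding disjoint_from_def
proof (intro ballI impI)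
  fix z assume z: "z \<in> carrier E" "z \<sqsubseteq> pos_part x" "z \<sqsubseteq> pos_part ((-1) \<bullet> x)"
  have "vabs E x \<sqsubseteq> vabs E x \<boxplus> (-2) \<bullet> z"
  proof (rule vabs_least)
    show "x \<sqsubseteq> vabs E x \<boxplus> (-2) \<bullet> z"
      by (rule le_scaled[OF z(3), of 2], use assms z in \<open>simp_all add: pos_part_def vabs_neg\<close>)
        (rule lin3[of x "vabs E x" z], use assms z in simp_all)
    show "(-1) \<bullet> x \<sqsubseteq> vabs E x \<boxplus> (-2) \<bullet> z"
      by (rule le_scaled[OF z(2), of 2], use assms z in \<open>simp_all add: pos_part_def\<close>)
        (rule lin3[of x "vabs E x" z], use assms z in simp_all)
  qed (use assms z in simp_all)
  then show "z \<sqsubseteq> \<Zero>"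
    by (rule le_scaled[of _ _ "1/2"], use assms z in simp_all)
      (rule lin3[of x "vabs E x" z], use assms z in simp_all)
qed

text \<open>A common lower bound \<open>w\<close> is treated in two rounds: \<open>w - y\<close>
  lies below \<open>x\<close> and \<open>z\<close>, so \<open>w \<sqsubseteq> y\<close>; then the
  disjointness of \<open>y\<close> and \<open>z\<close> applies.\<close>

lemma disjoint_add:
  assumes "disjoint_from x z" "disjoint_from y z" "\<Zero> \<sqsubseteq> y"
    and c: "x \<in> carrier E" "y \<in> carrier E" "z \<in> carrier E"
  shows "disjoint_from (x \<boxplus> y) z"
  unfolding disjoint_from_def
proof (intro ballI impI)
  fix w assume w: "w \<in> carrier E" "w \<sqsubseteq> x \<boxplus> y" "w \<sqsubseteq> z"
  have "w \<boxplus> (-1) \<bullet> y \<sqsubseteq> x"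
    by (rule le_scaled[OF w(2), of 1], use c w in simp_all)
      (rule lin3[of x y w], use c w in simp_all)
  moreover have "w \<boxplus> (-1) \<bullet> y \<sqsubseteq> z"
    by (rule le_combination[OF w(3) assms(3), of 1 1], use c w in simp_all)
      (rule lin4[of x y w z], use c w in simp_all)
  ultimately have "w \<boxplus> (-1) \<bullet> y \<sqsubseteq> \<Zero>"
    using assms(1) c w by (simp add: disjoint_from_def)
  then have "w \<sqsubseteq> y"
    by (rule le_scaled[of _ _ 1], use c w in simp_all)
      (rule lin3[of x y w], use c w in simp_all)
  then show "w \<sqsubseteq> \<Zero>"
    using assms(2) w by (simp add: disjoint_from_def)
qed

lemma disjoint_scale:
  assumes "disjoint_from x y" "\<Zero> \<sqsubseteq> x" "\<Zero> \<sqsubseteq> y" "0 \<le> a"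
    and c: "x \<in> carrier E" "y \<in> carrier E"
  shows "disjoint_from (a \<bullet> x) y"
  unfolding disjoint_from_def
proof (intro ballI impI)
  fix z assume z: "z \<in> carrier E" "z \<sqsubseteq> a \<bullet> x" "z \<sqsubseteq> y"
  \<comment> \<open>Dividing \<open>z\<close> by \<open>b\<close> has to bring it below
    \<open>x\<close> while keeping it below \<open>y\<close>. The second demand is why
    \<open>b\<close> is at least 1.\<close>
  define b where "b = max a 1"
  have b: "1 \<le> b" "a \<le> b" by (auto simp: b_def)
  have "z \<sqsubseteq> b \<bullet> x"
    using z(2) scale_left_mono[OF b(2) assms(2) c(1)] z(1) c by (meson le_trans scale_closed)
  then have "(1/b) \<bullet> z \<sqsubseteq> x"
    by (rule le_scaled[of _ _ "1/b"], use c z b in simp_all)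
      (rule lin2[of x z], use c z b in simp_all)
  moreover have "(1/b) \<bullet> z \<sqsubseteq> y"
    by (rule le_combination[OF z(3) assms(3), of "1/b" "1 - 1/b"], use c z b in simp_all)
      (rule lin3[of y z x], use c z b in \<open>simp_all add: field_simps\<close>)
  ultimately have "(1/b) \<bullet> z \<sqsubseteq> \<Zero>"
    using assms(1) z by (simp add: disjoint_from_def)
  then show "z \<sqsubseteq> \<Zero>"
    by (rule le_scaled[of _ _ b], use c z b in simp_all)
      (rule lin2[of x z], use c z b in simp_all)
qed

text \<open>The excess \<open>x + y - z\<close> is a common lower bound of \<open>x\<close> and
  \<open>y\<close>.\<close>

lemma disjoint_add_le:
  assumes "disjoint_from x y" "x \<sqsubseteq> z" "y \<sqsubseteq> z"
    and c: "x \<in> carrier E" "y \<in> carrier E" "z \<in> carrier E"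
  shows "x \<boxplus> y \<sqsubseteq> z"
proof -
  have "(x \<boxplus> y) \<boxplus> (-1) \<bullet> z \<sqsubseteq> x"
    by (rule le_scaled[OF assms(3), of 1], use c in simp_all)
      (rule lin3[of x y z], use c in simp_all)
  moreover have "(x \<boxplus> y) \<boxplus> (-1) \<bullet> z \<sqsubseteq> y"
    by (rule le_scaled[OF assms(2), of 1], use c in simp_all)
      (rule lin3[of x y z], use c in simp_all)
  ultimately have "(x \<boxplus> y) \<boxplus> (-1) \<bullet> z \<sqsubseteq> \<Zero>"
    using assms(1) c by (simp add: disjoint_from_def)
  then show ?thesis
    by (rule le_scaled[of _ _ 1], use c in simp_all)
      (rule lin3[of x y z], use c in simp_all)
qed

lemma vabs_add_disjoint:
  assumes d: "disjoint_from (vabs E x) (vabs E y)" and c: "x \<in> carrier E" "y \<in> carrier E"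
  shows "vabs E (x \<boxplus> y) = vabs E x \<boxplus> vabs E y"
proof (rule le_antisym)
  have half: "vabs E u \<sqsubseteq> vabs E (u \<boxplus> v) \<boxplus> vabs E v" if "u \<in> carrier E" "v \<in> carrier E" for u v
  proof -
    have "(u \<boxplus> v) \<boxplus> (-1) \<bullet> v = u"
      by (rule lin2[of u v], use that in simp_all)
    then show ?thesis
      using vabs_triangle[of "u \<boxplus> v" "(-1) \<bullet> v"] that by (simp add: vabs_neg)
  qed
  \<comment> \<open>Half of the defect in the triangle inequality. The reverse triangle inequality
    \<open>half\<close>, used both ways round, places it below \<open>vabs E y\<close> and below
    \<open>vabs E x\<close>.\<close>
  define w where "w = (1/2) \<bullet> ((vabs E x \<boxplus> vabs E y) \<boxplus> (-1) \<bullet> vabs E (x \<boxplus> y))"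
  have wc: "w \<in> carrier E" using c by (simp add: w_def)
  have "w \<sqsubseteq> vabs E y"
    by (rule le_scaled[OF half[OF c], of "1/2"], use c wc in simp_all, simp add: w_def)
      (rule lin4[of "vabs E x" "vabs E y" "vabs E (x \<boxplus> y)" x], use c in simp_all)
  moreover have "w \<sqsubseteq> vabs E x"
    using half[OF c(2,1)] unfolding add_comm[OF c(2,1)]
    by (rule le_scaled[of _ _ "1/2"], use c wc in simp_all, simp add: w_def)
      (rule lin4[of "vabs E x" "vabs E y" "vabs E (x \<boxplus> y)" x], use c in simp_all)
  ultimately have "w \<sqsubseteq> \<Zero>"
    using d wc by (simp add: disjoint_from_def)
  then show "vabs E x \<boxplus> vabs E y \<sqsubseteq> vabs E (x \<boxplus> y)"
    by (rule le_scaled[of _ _ 2], use c wc in simp_all, simp add: w_def)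
      (rule lin4[of "vabs E x" "vabs E y" "vabs E (x \<boxplus> y)" x], use c in simp_all)
qed (use c in \<open>simp_all add: vabs_triangle\<close>)

lemma riesz_decomposition:
  assumes le: "\<Zero> \<sqsubseteq> z" "z \<sqsubseteq> x \<boxplus> y" "\<Zero> \<sqsubseteq> x" "\<Zero> \<sqsubseteq> y"
    and c: "x \<in> carrier E" "y \<in> carrier E" "z \<in> carrier E"
  obtains u v where "u \<in> carrier E" "v \<in> carrier E" "\<Zero> \<sqsubseteq> u" "u \<sqsubseteq> x" "\<Zero> \<sqsubseteq> v" "v \<sqsubseteq> y" "u \<boxplus> v = z"
proof
  \<comment> \<open>\<open>?v\<close> is the excess of \<open>z\<close> over \<open>x\<close>; what
    remains of \<open>z\<close> is its meet with \<open>x\<close>.\<close>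
  let ?v = "pos_part (z \<boxplus> (-1) \<bullet> x)"
  let ?u = "z \<boxplus> (-1) \<bullet> ?v"
  have d: "z \<boxplus> (-1) \<bullet> x \<in> carrier E" using c by simp
  show "?u \<in> carrier E" "?v \<in> carrier E" "\<Zero> \<sqsubseteq> ?v" using c by simp_all
  have "z \<boxplus> (-1) \<bullet> x \<sqsubseteq> y"
    by (rule le_scaled[OF le(2), of 1], use c in simp_all)
      (rule lin3[of x y z], use c in simp_all)
  then show "?v \<sqsubseteq> y"
    using le c by (intro pos_part_least) simp_all
  have "z \<boxplus> (-1) \<bullet> x \<sqsubseteq> z"
    by (rule le_scaled[OF le(3), of 1], use c in simp_all)
      (rule lin3[of x y z], use c in simp_all)
  then have "?v \<sqsubseteq> z"
    using le c by (intro pos_part_least) simp_all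
  then show "\<Zero> \<sqsubseteq> ?u"
    using c le_iff_diff[of ?v z] by simp
  show "?u \<sqsubseteq> x"
    by (rule le_scaled[OF pos_part_ge[OF d], of 1], use c in simp_all)
      (rule lin3[of x ?v z], use c in simp_all)
  show "?u \<boxplus> ?v = z"
    by (rule lin3[of x ?v z], use c in simp_all)
qed

end

section \<open>Disjoint systems\<close>

context riesz_space
begin

text \<open>The additive group is read as a multiplicative monoid, so that \<open>finprod\<close>
  provides its finite sums.\<close>

definition vsum :: "('i \<Rightarrow> 'a) \<Rightarrow> 'i set \<Rightarrow> 'a" where
  "vsum f I = finprod \<lparr>carrier = carrier E, monoid.mult = vadd E, one = vzero E\<rparr> f I"

lemma vsum_empty [simp]: "vsum f {} = \<Zero>"
  using comm_monoid.finprod_empty[of "\<lparr>carrier = carrier E, monoid.mult = vadd E, one = vzero E\<rparr>"]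
    add_group by (simp add: vsum_def comm_group_def)

lemma vsum_insert [simp]:
  assumes "finite I" "i \<notin> I" "f i \<in> carrier E" "\<And>j. j \<in> I \<Longrightarrow> f j \<in> carrier E"
  shows "vsum f (insert i I) = f i \<boxplus> vsum f I"
  using comm_monoid.finprod_insert[of "\<lparr>carrier = carrier E, monoid.mult = vadd E, one = vzero E\<rparr>" I i f]
    add_group assms by (simp add: vsum_def comm_group_def)

lemma vsum_closed [simp]: "(\<And>i. i \<in> I \<Longrightarrow> f i \<in> carrier E) \<Longrightarrow> vsum f I \<in> carrier E"
  using comm_monoid.finprod_closed[of "\<lparr>carrier = carrier E, monoid.mult = vadd E, one = vzero E\<rparr>" f I]
    add_group by (simp add: vsum_def comm_group_def Pi_def)

lemma vsum_cong:
  assumes "\<And>i. i \<in> I \<Longrightarrow> f i = g i" "\<And>i. i \<in> I \<Longrightarrow> g i \<in> carrier E"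
  shows "vsum f I = vsum g I"
  using comm_monoid.finprod_cong[of "\<lparr>carrier = carrier E, monoid.mult = vadd E, one = vzero E\<rparr>" I I g f]
    add_group assms by (simp add: vsum_def comm_group_def Pi_def simp_implies_def)

lemma vsum_zero: "finite I \<Longrightarrow> vsum (\<lambda>_. \<Zero>) I = \<Zero>"
  by (induction I rule: finite_induct) simp_all

lemma vsum_add:
  assumes "finite I" "\<And>i. i \<in> I \<Longrightarrow> f i \<in> carrier E" "\<And>i. i \<in> I \<Longrightarrow> g i \<in> carrier E"
  shows "vsum (\<lambda>i. f i \<boxplus> g i) I = vsum f I \<boxplus> vsum g I"
  using assms
proof (induction I rule: finite_induct)
  case (insert i I)
  then show ?case by (simp add: add_interchange)
qed simp

lemma vsum_scale:
  assumes "finite I" "\<And>i. i \<in> I \<Longrightarrow> f i \<in> carrier E"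
  shows "a \<bullet> vsum f I = vsum (\<lambda>i. a \<bullet> f i) I"
  using assms
proof (induction I rule: finite_induct)
  case (insert i I)
  then show ?case by (simp add: scale_add_right)
qed simp

lemma vsum_swap:
  assumes "finite I" "finite J" "\<And>i j. i \<in> I \<Longrightarrow> j \<in> J \<Longrightarrow> f i j \<in> carrier E"
  shows "vsum (\<lambda>i. vsum (f i) J) I = vsum (\<lambda>j. vsum (\<lambda>i. f i j) I) J"
  using assms
proof (induction I rule: finite_induct)
  case (insert i I)
  have "vsum (\<lambda>j. vsum (\<lambda>i. f i j) (insert i I)) J = vsum (\<lambda>j. f i j \<boxplus> vsum (\<lambda>i. f i j) I) J"
    using insert by (intro vsum_cong) simp_all
  then show ?case using insert by (simp add: vsum_add)
qed (simp add: vsum_zero)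

lemma vsum_nonneg:
  assumes "finite I" "\<And>i. i \<in> I \<Longrightarrow> f i \<in> carrier E" "\<And>i. i \<in> I \<Longrightarrow> \<Zero> \<sqsubseteq> f i"
  shows "\<Zero> \<sqsubseteq> vsum f I"
  using assms
proof (induction I rule: finite_induct)
  case (insert i I)
  then show ?case by (simp add: add_nonneg)
qed simp

lemma le_vsum:
  assumes "finite I" "\<And>i. i \<in> I \<Longrightarrow> f i \<in> carrier E" "\<And>i. i \<in> I \<Longrightarrow> \<Zero> \<sqsubseteq> f i" "k \<in> I"
  shows "f k \<sqsubseteq> vsum f I"
proof -
  have "vsum f I = f k \<boxplus> vsum f (I - {k})"
    using assms vsum_insert[of "I - {k}" k f] by (simp add: insert_absorb)
  moreover have "\<Zero> \<sqsubseteq> vsum f (I - {k})"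
    using assms by (intro vsum_nonneg) auto
  moreover have "vsum f (I - {k}) \<in> carrier E"
    using assms by (intro vsum_closed) auto
  ultimately show ?thesis
    using assms(2)[OF assms(4)] le_add_right[of "vsum f (I - {k})" "f k"] by simp
qed

lemma vsum_in_linear_subspace:
  assumes "linear_subspace E S" "finite I" "\<And>i. i \<in> I \<Longrightarrow> f i \<in> S"
  shows "vsum f I \<in> S"
  using assms(2,3)
proof (induction I rule: finite_induct)
  case empty
  then show ?case using assms(1) by (simp add: linear_subspace_def)
next
  case (insert i I)
  moreover have "S \<subseteq> carrier E" using assms(1) by (simp add: linear_subspace_def)
  ultimately have "vsum f (insert i I) = f i \<boxplus> vsum f I"
    by (intro vsum_insert) auto
  then show ?case
    using insert assms(1) by (simp add: linear_subspace_def)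
qed

lemma additive_vsum:
  fixes f :: "'a \<Rightarrow> real"
  assumes "\<And>x y. x \<in> carrier E \<Longrightarrow> y \<in> carrier E \<Longrightarrow> f (x \<boxplus> y) = f x + f y"
    and "finite I" "\<And>i. i \<in> I \<Longrightarrow> g i \<in> carrier E"
  shows "f (vsum g I) = (\<Sum>i\<in>I. f (g i))"
  using assms(2,3)
proof (induction I rule: finite_induct)
  case empty
  then show ?case using assms(1)[of \<Zero> \<Zero>] by simp
next
  case (insert i I)
  then show ?case by (simp add: assms(1))
qed

lemma vsum_scale_left:
  assumes "finite I" "x \<in> carrier E"
  shows "vsum (\<lambda>i. a i \<bullet> x) I = (\<Sum>i\<in>I. a i) \<bullet> x"
  using assms(1)
proof (induction I rule: finite_induct)
  case (insert i I)
  then show ?case using assms(2) by (simp add: scale_add_left)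
qed (simp add: assms(2))

lemma disjoint_vsum:
  assumes "finite I" "\<And>i. i \<in> I \<Longrightarrow> f i \<in> carrier E" "\<And>i. i \<in> I \<Longrightarrow> \<Zero> \<sqsubseteq> f i"
    "\<And>i. i \<in> I \<Longrightarrow> disjoint_from (f i) z" "z \<in> carrier E"
  shows "disjoint_from (vsum f I) z"
  using assms
proof (induction I rule: finite_induct)
  case empty
  then show ?case by (simp add: disjoint_from_def)
next
  case (insert i I)
  then show ?case by (simp add: disjoint_add vsum_nonneg)
qed

section \<open>Linear combinations and spans\<close>

definition lincomb :: "('a \<Rightarrow> real) \<Rightarrow> 'a set \<Rightarrow> 'a" where
  "lincomb c U = vsum (\<lambda>u. c u \<bullet> u) U"

lemma lincomb_closed [simp]: "U \<subseteq> carrier E \<Longrightarrow> lincomb c U \<in> carrier E"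
  unfolding lincomb_def by (rule vsum_closed) auto

lemma lincomb_insert:
  "finite U \<Longrightarrow> u \<notin> U \<Longrightarrow> insert u U \<subseteq> carrier E \<Longrightarrow> lincomb c (insert u U) = c u \<bullet> u \<boxplus> lincomb c U"
  unfolding lincomb_def by (rule vsum_insert) auto

lemma lincomb_cong:
  "(\<And>u. u \<in> U \<Longrightarrow> c u = d u) \<Longrightarrow> U \<subseteq> carrier E \<Longrightarrow> lincomb c U = lincomb d U"
  unfolding lincomb_def by (intro vsum_cong) auto

lemma lincomb_add:
  assumes "finite U" "U \<subseteq> carrier E"
  shows "lincomb c U \<boxplus> lincomb d U = lincomb (\<lambda>u. c u + d u) U"
proof -
  have "lincomb (\<lambda>u. c u + d u) U = vsum (\<lambda>u. c u \<bullet> u \<boxplus> d u \<bullet> u) U"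
    unfolding lincomb_def using assms by (intro vsum_cong) (auto simp: scale_add_left)
  also have "\<dots> = lincomb c U \<boxplus> lincomb d U"
    unfolding lincomb_def using assms by (intro vsum_add) auto
  finally show ?thesis ..
qed

lemma lincomb_scale:
  assumes "finite U" "U \<subseteq> carrier E"
  shows "a \<bullet> lincomb c U = lincomb (\<lambda>u. a * c u) U"
proof -
  have "a \<bullet> lincomb c U = vsum (\<lambda>u. a \<bullet> c u \<bullet> u) U"
    unfolding lincomb_def using assms by (intro vsum_scale) auto
  also have "\<dots> = lincomb (\<lambda>u. a * c u) U"
    unfolding lincomb_def using assms by (intro vsum_cong) (auto simp: scale_scale)
  finally show ?thesis .
qed

lemma linear_subspace_lincombs:
  assumes "finite U" "U \<subseteq> carrier E"
  shows "linear_subspace E (range (\<lambda>c. lincomb c U))"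
proof -
  have "\<Zero> = lincomb (\<lambda>_. 0) U"
    using lincomb_scale[OF assms, of 0 "\<lambda>_. 0"] assms by simp
  then show ?thesis
    using assms by (auto simp: linear_subspace_def lincomb_add lincomb_scale)
qed

lemma lincomb_single:
  assumes "finite U" "U \<subseteq> carrier E" "u \<in> U"
  shows "lincomb (\<lambda>v. if v = u then 1 else 0) U = u"
proof -
  have "lincomb (\<lambda>v. if v = u then 1 else 0) (U - {u}) = \<Zero>"
    using assms lincomb_cong[of "U - {u}" "\<lambda>v. if v = u then 1 else 0" "\<lambda>_. 0"]
      lincomb_scale[of "U - {u}" 0 "\<lambda>_. 0"] lincomb_closed[of "U - {u}"]
    by (simp add: subset_eq)
  then show ?thesis
    using assms lincomb_insert[of "U - {u}" u "\<lambda>v. if v = u then 1 else 0"]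
    by (auto simp: insert_absorb scale_one)
qed

lemma span_eq_lincombs:
  assumes "finite B" "B \<subseteq> carrier E" "x \<in> linear_subspace E hull B"
  shows "\<exists>c. x = lincomb c B"
proof -
  have "B \<subseteq> range (\<lambda>c. lincomb c B)"
    using lincomb_single[OF assms(1,2)] by (metis rangeI subsetI)
  then have "linear_subspace E hull B \<subseteq> range (\<lambda>c. lincomb c B)"
    using assms by (intro hull_minimal linear_subspace_lincombs)
  then show ?thesis using assms(3) by auto
qed

section \<open>Disjoint systems as coordinate systems\<close>

definition disjoint_system :: "'a set \<Rightarrow> bool" where
  "disjoint_system U \<longleftrightarrow> U \<subseteq> carrier E \<and> (\<forall>u\<in>U. \<Zero> \<sqsubseteq> u \<and> u \<noteq> \<Zero>) \<and>
    (\<forall>u\<in>U. \<forall>v\<in>U. u \<noteq> v \<longrightarrow> disjoint_from u v)"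

text \<open>Multiples of disjoint positive vectors stay disjoint, so
  \<open>vabs_add_disjoint\<close> splits off one term at a time.\<close>

lemma vabs_lincomb:
  assumes "finite U" "disjoint_system U"
  shows "vabs E (lincomb c U) = lincomb (\<lambda>u. \<bar>c u\<bar>) U"
  using assms
proof (induction U rule: finite_induct)
  case empty
  then show ?case by (simp add: lincomb_def vabs_of_nonneg)
next
  case (insert u U)
  have U: "U \<subseteq> carrier E" "u \<in> carrier E" "disjoint_system U" "\<Zero> \<sqsubseteq> u"
    using insert.prems by (auto simp: disjoint_system_def)
  have d: "disjoint_from (\<bar>c v\<bar> \<bullet> v) (\<bar>c u\<bar> \<bullet> u)" if "v \<in> U" for v
  proof -
    have v: "v \<in> carrier E" "\<Zero> \<sqsubseteq> v" "disjoint_from v u"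
      using insert.prems insert.hyps that by (auto simp: disjoint_system_def)
    show ?thesis
      using disjoint_scale[OF v(3,2) U(4) _ v(1) U(2), of "\<bar>c v\<bar>"]
        disjoint_scale[of u "\<bar>c v\<bar> \<bullet> v" "\<bar>c u\<bar>"] v U
      by (simp add: disjoint_from_commute scale_nonneg)
  qed
  have "disjoint_from (lincomb (\<lambda>u. \<bar>c u\<bar>) U) (\<bar>c u\<bar> \<bullet> u)"
    unfolding lincomb_def
    using insert.prems insert.hyps d by (intro disjoint_vsum) (auto simp: disjoint_system_def intro: scale_nonneg)
  then have "disjoint_from (vabs E (c u \<bullet> u)) (vabs E (lincomb c U))"
    using insert.IH U by (simp add: vabs_scale_nonneg disjoint_from_commute)
  then show ?case
    using insert U by (simp add: lincomb_insert vabs_add_disjoint vabs_scale_nonneg)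
qed

text \<open>A vanishing combination has vanishing absolute value, and by \<open>vabs_lincomb\<close>
  this is a sum of positive terms which dominates each of them.\<close>

lemma disjoint_system_independent:
  assumes U: "finite U" "disjoint_system U" and zero: "lincomb c U = \<Zero>" and u: "u \<in> U"
  shows "c u = 0"
proof (rule ccontr)
  assume "c u \<noteq> 0"
  have uc: "u \<in> carrier E" "\<Zero> \<sqsubseteq> u" "u \<noteq> \<Zero>" using U u by (auto simp: disjoint_system_def)
  have "lincomb (\<lambda>u. \<bar>c u\<bar>) U = \<Zero>"
    using vabs_lincomb[OF U, of c] zero by (simp add: vabs_of_nonneg)
  moreover have "\<bar>c u\<bar> \<bullet> u \<sqsubseteq> lincomb (\<lambda>u. \<bar>c u\<bar>) U"
    unfolding lincomb_def
    by (rule le_vsum) (use U u in \<open>auto simp: disjoint_system_def intro: scale_nonneg\<close>)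
  ultimately have "\<bar>c u\<bar> \<bullet> u \<sqsubseteq> \<Zero>" by simp
  then have "u \<sqsubseteq> \<Zero>"
    by (rule le_scaled[of _ _ "1 / \<bar>c u\<bar>"], use uc in simp_all)
      (rule lin1[of u], use uc \<open>c u \<noteq> 0\<close> in simp_all)
  then show False using le_antisym[OF _ uc(2)] uc by simp
qed

lemma disjoint_system_unique:
  assumes "finite U" "disjoint_system U" "lincomb c U = lincomb d U" "u \<in> U"
  shows "c u = d u"
proof -
  have UE: "U \<subseteq> carrier E" using assms by (simp add: disjoint_system_def)
  have "lincomb (\<lambda>u. c u + (-1) * d u) U = lincomb c U \<boxplus> (-1) \<bullet> lincomb d U"
    using lincomb_add[OF assms(1) UE] lincomb_scale[OF assms(1) UE] by simp
  also have "\<dots> = \<Zero>"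
    unfolding assms(3) by (rule lin1[of "lincomb d U"], use UE in simp_all)
  finally show ?thesis
    using disjoint_system_independent[OF assms(1,2) _ assms(4), of "\<lambda>u. c u + (-1) * d u"] by simp
qed

text \<open>Sums of pairwise disjoint positive vectors behave like suprema, by induction with
  \<open>disjoint_add_le\<close>.\<close>

lemma disjoint_vsum_le:
  assumes "finite I" "\<And>i. i \<in> I \<Longrightarrow> f i \<in> carrier E" "\<And>i. i \<in> I \<Longrightarrow> \<Zero> \<sqsubseteq> f i"
    "\<And>i j. i \<in> I \<Longrightarrow> j \<in> I \<Longrightarrow> i \<noteq> j \<Longrightarrow> disjoint_from (f i) (f j)"
    "\<And>i. i \<in> I \<Longrightarrow> f i \<sqsubseteq> x" "\<Zero> \<sqsubseteq> x" "x \<in> carrier E"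
  shows "vsum f I \<sqsubseteq> x"
  using assms
proof (induction I rule: finite_induct)
  case (insert i I)
  have "disjoint_from (vsum f I) (f i)"
    using insert.prems insert.hyps by (intro disjoint_vsum) auto
  then have "f i \<boxplus> vsum f I \<sqsubseteq> x"
    using insert by (intro disjoint_add_le) (auto simp: disjoint_from_commute)
  then show ?case using insert by simp
qed simp

end

text \<open>Gaussian elimination for a homogeneous system with fewer equations than unknowns: a
  pivot \<open>k\<close> in equation \<open>b\<close> leaves a system with one equation and one
  unknown less.\<close>

lemma nontrivial_relation:
  fixes c :: "'j \<Rightarrow> 'b \<Rightarrow> real"
  assumes "finite B" "finite J" "card B < card J"
  shows "\<exists>d. (\<exists>j\<in>J. d j \<noteq> 0) \<and> (\<forall>b\<in>B. (\<Sum>j\<in>J. d j * c j b) = 0)"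
  using assms
proof (induction B arbitrary: J c rule: finite_induct)
  case empty
  then show ?case by (intro exI[of _ "\<lambda>_. 1"]) (auto simp: card_gt_0_iff)
next
  case (insert b B)
  show ?case
  proof (cases "\<forall>j\<in>J. c j b = 0")
    case True
    moreover obtain d where "\<exists>j\<in>J. d j \<noteq> 0" "\<forall>b\<in>B. (\<Sum>j\<in>J. d j * c j b) = 0"
      using insert by (metis Suc_lessD card_insert_disjoint)
    ultimately show ?thesis by (intro exI[of _ d]) auto
  next
    case False
    then obtain k where k: "k \<in> J" "c k b \<noteq> 0" by auto
    let ?J = "J - {k}"
    have "card B < card ?J" using insert k by simp
    then obtain d where d: "\<exists>j\<in>?J. d j \<noteq> 0"
      and d0: "\<forall>b'\<in>B. (\<Sum>j\<in>?J. d j * (c j b' - c j b / c k b * c k b')) = 0"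
      using insert.IH[of ?J "\<lambda>j b'. c j b' - c j b / c k b * c k b'"] insert.prems by auto
    \<comment> \<open>The pivot unknown is solved from equation \<open>b\<close>; its effect on the
      other equations is already contained in the reduced coefficients.\<close>
    define d' where "d' = d(k := - (\<Sum>j\<in>?J. d j * c j b) / c k b)"
    have sum: "(\<Sum>j\<in>J. d' j * c j b') = (\<Sum>j\<in>?J. d j * (c j b' - c j b / c k b * c k b'))" for b'
    proof -
      have "(\<Sum>j\<in>J. d' j * c j b') = d' k * c k b' + (\<Sum>j\<in>?J. d j * c j b')"
        using insert.prems k by (simp add: sum.remove[of J k] d'_def)
      also have "\<dots> = (\<Sum>j\<in>?J. d j * (c j b' - c j b / c k b * c k b'))"
        by (simp add: d'_def right_diff_distrib sum_subtractf sum_divide_distrib sum_distrib_right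
            mult.assoc)
      finally show ?thesis .
    qed
    have "(\<Sum>j\<in>?J. d j * (c j b - c j b / c k b * c k b)) = 0"
      using k by simp
    then have "\<forall>b'\<in>insert b B. (\<Sum>j\<in>J. d' j * c j b') = 0"
      unfolding sum using d0 by simp
    then show ?thesis using d by (intro exI[of _ d']) (auto simp: d'_def)
  qed
qed

section \<open>Disjoint bases in Archimedean Riesz spaces\<close>

context riesz_space
begin

text \<open>Too many vectors would have linearly dependent coordinates over \<open>B\<close>, and so
  a nontrivial vanishing combination, against \<open>disjoint_system_independent\<close>.\<close>

lemma card_disjoint_system_le:
  assumes U: "finite U" "disjoint_system U" and B: "finite B" "B \<subseteq> carrier E"
    and span: "\<And>u. u \<in> U \<Longrightarrow> \<exists>c. u = lincomb c B"
  shows "card U \<le> card B"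
proof (rule ccontr)
  assume "\<not> card U \<le> card B"
  have UE: "U \<subseteq> carrier E" using U by (simp add: disjoint_system_def)
  obtain c where c: "u = lincomb (c u) B" if "u \<in> U" for u
    using span by metis
  obtain d where d: "\<exists>u\<in>U. d u \<noteq> 0" "\<forall>b\<in>B. (\<Sum>u\<in>U. d u * c u b) = 0"
    using nontrivial_relation[OF B(1) U(1), of c] \<open>\<not> card U \<le> card B\<close> by auto
  have "lincomb d U = vsum (\<lambda>u. vsum (\<lambda>b. (d u * c u b) \<bullet> b) B) U"
    unfolding lincomb_def
  proof (rule vsum_cong)
    fix u assume "u \<in> U"
    then show "d u \<bullet> u = vsum (\<lambda>b. (d u * c u b) \<bullet> b) B"
      using c[of u] lincomb_scale[OF B, of "d u" "c u"] by (simp add: lincomb_def)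
  qed (use B in \<open>intro vsum_closed; auto\<close>)
  also have "\<dots> = vsum (\<lambda>b. vsum (\<lambda>u. (d u * c u b) \<bullet> b) U) B"
    using U B by (intro vsum_swap) auto
  also have "\<dots> = vsum (\<lambda>_. \<Zero>) B"
    using B U d(2) by (intro vsum_cong) (auto simp: vsum_scale_left)
  finally have "lincomb d U = \<Zero>" by (simp add: B vsum_zero)
  then show False
    using disjoint_system_independent[OF U] d(1) by blast
qed

lemma archimedeanD:
  "archimedean E \<Longrightarrow> x \<in> carrier E \<Longrightarrow> y \<in> carrier E \<Longrightarrow> \<Zero> \<sqsubseteq> x \<Longrightarrow>
    (\<And>n. real n \<bullet> x \<sqsubseteq> y) \<Longrightarrow> x = \<Zero>"
  unfolding archimedean_def by blast

text \<open>The positive part of \<open>x - y\<close> lies below \<open>u/n\<close> for every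
  positive \<open>n\<close>, so all its multiples stay below \<open>u\<close> and it
  vanishes.\<close>

lemma archimedean_le:
  assumes arch: "archimedean E" and c: "x \<in> carrier E" "y \<in> carrier E" "u \<in> carrier E"
    and u: "\<Zero> \<sqsubseteq> u" and le: "\<And>e. 0 < e \<Longrightarrow> x \<sqsubseteq> y \<boxplus> e \<bullet> u"
  shows "x \<sqsubseteq> y"
proof -
  let ?w = "pos_part (x \<boxplus> (-1) \<bullet> y)"
  have "real n \<bullet> ?w \<sqsubseteq> u" for n
  proof (cases "n = 0")
    case True
    then show ?thesis using u c by simp
  next
    case False
    have "x \<boxplus> (-1) \<bullet> y \<sqsubseteq> (1 / real n) \<bullet> u"
      by (rule le_scaled[OF le[of "1 / real n"], of 1], use c False in simp_all)
        (rule lin3[of x y u], use c in simp_all)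
    then have "?w \<sqsubseteq> (1 / real n) \<bullet> u"
      using c u by (intro pos_part_least) (simp_all add: scale_nonneg)
    then show ?thesis
      by (rule le_scaled[of _ _ "real n"], use c in simp_all)
        (rule lin2[of ?w u], use c False in simp_all)
  qed
  then have "?w = \<Zero>"
    using c by (intro archimedeanD[OF arch _ c(3)]) simp_all
  then have "x \<boxplus> (-1) \<bullet> y \<sqsubseteq> \<Zero>"
    using pos_part_ge[of "x \<boxplus> (-1) \<bullet> y"] c by simp
  then show ?thesis
    by (rule le_scaled[of _ _ 1], use c in simp_all) (rule lin2[of x y], use c in simp_all)
qed

text \<open>If the admissible coefficients were unbounded, all multiples of \<open>u\<close> would
  lie below \<open>x\<close>. Their supremum is itself admissible by \<open>archimedean_le\<close>,
  because approximating it from below costs only a small multiple of \<open>u\<close>.\<close>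

lemma archimedean_greatest_multiple:
  assumes arch: "archimedean E" and c: "x \<in> carrier E" "u \<in> carrier E"
    and u: "\<Zero> \<sqsubseteq> u" "u \<noteq> \<Zero>" and x: "\<Zero> \<sqsubseteq> x"
  obtains t where "0 \<le> t" "t \<bullet> u \<sqsubseteq> x" "\<And>s. s \<bullet> u \<sqsubseteq> x \<Longrightarrow> s \<le> t"
proof -
  define S where "S = {s. s \<bullet> u \<sqsubseteq> x}"
  have 0: "0 \<in> S" using x c by (simp add: S_def)
  have "bdd_above S"
  proof (rule ccontr)
    assume unb: "\<not> bdd_above S"
    have "real n \<bullet> u \<sqsubseteq> x" for n
    proof -
      obtain s where s: "s \<in> S" "real n < s"
        using unb by (metis bdd_above.I linorder_not_le)
      then have "real n \<bullet> u \<sqsubseteq> s \<bullet> u" using c u by (intro scale_left_mono) auto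
      moreover have "s \<bullet> u \<sqsubseteq> x" using s by (simp add: S_def)
      ultimately show ?thesis using c by (meson le_trans scale_closed)
    qed
    then show False using archimedeanD[OF arch c(2,1) u(1)] u(2) by blast
  qed
  then have upper: "s \<le> Sup S" if "s \<bullet> u \<sqsubseteq> x" for s
    using that by (auto simp: S_def intro: cSup_upper)
  have "Sup S \<bullet> u \<sqsubseteq> x"
  proof (rule archimedean_le[OF arch _ c(1) c(2) u(1)])
    fix e :: real assume "0 < e"
    then obtain s where s: "s \<in> S" "Sup S - e < s"
      using less_cSup_iff[of S "Sup S - e"] 0 \<open>bdd_above S\<close> by auto
    have "Sup S \<bullet> u \<sqsubseteq> (s + e) \<bullet> u" using s c u by (intro scale_left_mono) auto
    moreover have "s \<bullet> u \<boxplus> e \<bullet> u \<sqsubseteq> x \<boxplus> e \<bullet> u"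
      using s c by (intro add_mono) (auto simp: S_def)
    ultimately show "Sup S \<bullet> u \<sqsubseteq> x \<boxplus> e \<bullet> u"
      using c le_trans[of "Sup S \<bullet> u" "(s + e) \<bullet> u" "x \<boxplus> e \<bullet> u"] by (simp add: scale_add_left)
  qed (use c in simp)
  moreover have "0 \<le> Sup S" using upper[of 0] 0 by (simp add: S_def)
  ultimately show ?thesis using upper that by blast
qed

lemma riesz_subspace_vabs:
  "riesz_subspace E S \<Longrightarrow> x \<in> S \<Longrightarrow> vabs E x \<in> S"
  unfolding riesz_subspace_def linear_subspace_def vabs_def by blast

lemma riesz_subspace_pos_part:
  "riesz_subspace E S \<Longrightarrow> x \<in> S \<Longrightarrow> pos_part x \<in> S"
  using riesz_subspace_vabs[of S x] unfolding riesz_subspace_def linear_subspace_def pos_part_def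
  by blast

text \<open>
  The basis is a disjoint system of maximal cardinality. By maximality no element of it dominates
  two disjoint nonzero vectors of \<open>G\<close>, so that, \<open>E\<close> being Archimedean, it is an atom.
\<close>

theorem finite_dimensional_disjoint_basis:
  assumes arch: "archimedean E" and G: "riesz_subspace E G" and fd: "finite_dimensional E G"
  obtains U where "finite U" "disjoint_system U" "\<And>x. x \<in> G \<Longrightarrow> \<exists>c. x = lincomb c U"
proof -
  have Gadd: "x \<boxplus> y \<in> G" and Gmeet: "x \<sqinter> y \<in> G" if "x \<in> G" "y \<in> G" for x y
    using G that unfolding riesz_subspace_def linear_subspace_def by blast+
  have GE: "x \<in> carrier E" and Gscale: "a \<bullet> x \<in> G" if "x \<in> G" for x a
    using G that unfolding riesz_subspace_def linear_subspace_def by blast+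
  obtain B where B: "finite B" "B \<subseteq> G" "linear_subspace E hull B = G"
    using fd by (auto simp: finite_dimensional_def)
  have BE: "B \<subseteq> carrier E" using B GE by auto
  define P where "P U \<longleftrightarrow> finite U \<and> disjoint_system U \<and> U \<subseteq> G" for U
  \<comment> \<open>The strict bound, with \<open>Suc\<close>, is the form that
    \<open>ex_has_greatest_nat\<close> takes.\<close>
  have "card U < Suc (card B)" if "P U" for U
  proof -
    have "card U \<le> card B"
      using that B span_eq_lincombs[OF B(1) BE]
      by (intro card_disjoint_system_le[OF _ _ B(1) BE]) (auto simp: P_def)
    then show ?thesis by simp
  qed
  moreover have "P {}" by (simp add: P_def disjoint_system_def)
  ultimately obtain U where PU: "P U" and max: "\<And>V. P V \<Longrightarrow> card V \<le> card U"
    using ex_has_greatest_nat[of P "{}" card "Suc (card B)"] by (metis less_imp_le_nat)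
  have U: "finite U" "disjoint_system U" "U \<subseteq> G" using PU by (auto simp: P_def)
  have Uprops: "u \<in> G" "u \<in> carrier E" "\<Zero> \<sqsubseteq> u" "u \<noteq> \<Zero>" if "u \<in> U" for u
    using that U GE by (auto simp: disjoint_system_def)
  have Udisj: "disjoint_from u v" if "u \<in> U" "v \<in> U" "u \<noteq> v" for u v
    using that U by (auto simp: disjoint_system_def)
  have UE: "U \<subseteq> carrier E" using Uprops by auto
  have self: "x = \<Zero>" if "disjoint_from x x" "x \<in> carrier E" "\<Zero> \<sqsubseteq> x" for x
    using that by (auto simp: disjoint_from_def intro: le_antisym)

  \<comment> \<open>Otherwise \<open>w\<close> would enlarge \<open>U\<close>; it is not yet a
    member, since a positive vector disjoint from itself is zero.\<close>
  have complete: "w = \<Zero>" if w: "w \<in> G" "\<Zero> \<sqsubseteq> w" "\<And>u. u \<in> U \<Longrightarrow> disjoint_from w u" for w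
  proof (rule ccontr)
    assume "w \<noteq> \<Zero>"
    then have "w \<notin> U" using self[of w] w GE by blast
    have "P (insert w U)"
      unfolding P_def disjoint_system_def
      using U Udisj Uprops w GE \<open>w \<noteq> \<Zero>\<close> disjoint_from_commute by auto
    then show False using max[of "insert w U"] U \<open>w \<notin> U\<close> by simp
  qed
  \<comment> \<open>If both were nonzero, replacing \<open>u\<close> by the pair \<open>p\<close>,
    \<open>q\<close> would give a disjoint system with one more element: vectors below
    \<open>u\<close> inherit its disjointness from the rest.\<close>
  have indecomposable: "p = \<Zero> \<or> q = \<Zero>"
    if u: "u \<in> U" and pq: "p \<in> G" "q \<in> G" "\<Zero> \<sqsubseteq> p" "\<Zero> \<sqsubseteq> q" "p \<sqsubseteq> u" "q \<sqsubseteq> u" "disjoint_from p q"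
    for u p q
  proof (rule ccontr)
    assume nz: "\<not> (p = \<Zero> \<or> q = \<Zero>)"
    let ?W = "U - {u}"
    have d: "disjoint_from r v" if "v \<in> ?W" "r \<sqsubseteq> u" "r \<in> G" for r v
      using Udisj[of u v] that u Uprops GE
      by (intro disjoint_from_mono[of u v r v]) auto
    have "p \<noteq> q" using nz pq self GE by blast
    moreover have "p \<notin> ?W" "q \<notin> ?W" using d[of p p] d[of q q] nz pq self GE by blast+
    ultimately have "card (insert p (insert q ?W)) = Suc (card U)"
      using U u by (simp add: card_Suc_Diff1[OF U(1) u] del: card_Diff_insert card_Diff_singleton)
    moreover have "P (insert p (insert q ?W))"
      unfolding P_def disjoint_system_def
      using U Udisj Uprops d pq GE nz disjoint_from_commute by auto
    ultimately show False using max by (metis Suc_n_not_le_n)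
  qed
  have multiple: "\<exists>t. v = t \<bullet> u" if u: "u \<in> U" and v: "v \<in> G" "\<Zero> \<sqsubseteq> v" "v \<sqsubseteq> u" for u v
  proof -
    note c = Uprops(2)[OF u] GE[OF v(1)]
    \<comment> \<open>The positive parts of \<open>v - s u\<close> and of its negative are disjoint
      and, as \<open>s\<close> lies between 0 and 1, both below \<open>u\<close>. So one of them
      vanishes, which makes \<open>v\<close> and \<open>s u\<close> comparable.\<close>
    have cases: "v \<sqsubseteq> s \<bullet> u \<or> s \<bullet> u \<sqsubseteq> v" if s: "0 \<le> s" "s \<le> 1" for s
    proof -
      let ?d = "v \<boxplus> (-1) \<bullet> s \<bullet> u"
      have dG: "?d \<in> G" by (intro Gadd Gscale v(1) Uprops(1)[OF u])
      have "?d \<sqsubseteq> u"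
        by (rule le_combination[OF v(3) Uprops(3)[OF u], of 1 s], use c s in simp_all)
          (rule lin2[of u v], use c in simp_all)
      then have p: "pos_part ?d \<sqsubseteq> u" using Uprops[OF u] c by (intro pos_part_least) simp_all
      have "(-1) \<bullet> ?d \<sqsubseteq> u"
        by (rule le_combination[OF v(2) Uprops(3)[OF u], of 1 "1 - s"], use c s in simp_all)
          (rule lin2[of u v], use c in simp_all)
      then have q: "pos_part ((-1) \<bullet> ?d) \<sqsubseteq> u" using Uprops[OF u] c by (intro pos_part_least) simp_all
      have "pos_part ?d = \<Zero> \<or> pos_part ((-1) \<bullet> ?d) = \<Zero>"
        using indecomposable[OF u riesz_subspace_pos_part[OF G dG]
            riesz_subspace_pos_part[OF G Gscale[OF dG]] _ _ p q disjoint_pos_parts] c by simp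
      then have "?d \<sqsubseteq> \<Zero> \<or> (-1) \<bullet> ?d \<sqsubseteq> \<Zero>"
        using pos_part_ge[of ?d] pos_part_ge[of "(-1) \<bullet> ?d"] c
        by (metis add_closed scale_closed)
      then show ?thesis
      proof
        assume "?d \<sqsubseteq> \<Zero>"
        then have "v \<sqsubseteq> s \<bullet> u"
          by (rule le_scaled[of _ _ 1], use c in simp_all) (rule lin2[of u v], use c in simp_all)
        then show ?thesis ..
      next
        assume "(-1) \<bullet> ?d \<sqsubseteq> \<Zero>"
        then have "s \<bullet> u \<sqsubseteq> v"
          by (rule le_scaled[of _ _ 1], use c in simp_all) (rule lin2[of u v], use c in simp_all)
        then show ?thesis ..
      qed
    qed
    obtain t where t: "0 \<le> t" "t \<bullet> u \<sqsubseteq> v" "\<And>s. s \<bullet> u \<sqsubseteq> v \<Longrightarrow> s \<le> t"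
      using archimedean_greatest_multiple[OF arch c(2,1) Uprops(3,4)[OF u] v(2)] by blast
    \<comment> \<open>For a coefficient \<open>t + e\<close> up to 1, maximality of \<open>t\<close>
      excludes the second alternative of \<open>cases\<close>; beyond 1 the hypothesis
      \<open>v \<sqsubseteq> u\<close> is enough.\<close>
    have "v \<sqsubseteq> t \<bullet> u"
    proof (rule archimedean_le[OF arch c(2) _ c(1) Uprops(3)[OF u]])
      fix e :: real assume "0 < e"
      have "v \<sqsubseteq> (t + e) \<bullet> u"
      proof (cases "t + e \<le> 1")
        case True
        then show ?thesis using cases[of "t + e"] t(1) t(3)[of "t + e"] \<open>0 < e\<close> by linarith
      next
        case False
        then have "u \<sqsubseteq> (t + e) \<bullet> u"
          using scale_left_mono[of 1 "t + e" u] Uprops[OF u] by (simp add: scale_one)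
        then show ?thesis using v(3) c by (meson le_trans scale_closed)
      qed
      then show "v \<sqsubseteq> t \<bullet> u \<boxplus> e \<bullet> u" using c by (simp add: scale_add_left)
    qed (use c in simp)
    then have "v = t \<bullet> u" using t c by (intro le_antisym) simp_all
    then show ?thesis ..
  qed
  have positive: "\<exists>c. x = lincomb c U" if x: "x \<in> G" "\<Zero> \<sqsubseteq> x" for x
  proof -
    have "\<forall>u\<in>U. \<exists>t\<ge>0. t \<bullet> u \<sqsubseteq> x \<and> (\<forall>s. s \<bullet> u \<sqsubseteq> x \<longrightarrow> s \<le> t)"
    proof
      fix u assume "u \<in> U"
      then show "\<exists>t\<ge>0. t \<bullet> u \<sqsubseteq> x \<and> (\<forall>s. s \<bullet> u \<sqsubseteq> x \<longrightarrow> s \<le> t)"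
        using archimedean_greatest_multiple[OF arch GE[OF x(1)] Uprops(2-4) x(2)] by metis
    qed
    then obtain t where "\<forall>u\<in>U. 0 \<le> t u \<and> t u \<bullet> u \<sqsubseteq> x \<and> (\<forall>s. s \<bullet> u \<sqsubseteq> x \<longrightarrow> s \<le> t u)"
      unfolding bchoice_iff by blast
    then have t: "0 \<le> t u" "t u \<bullet> u \<sqsubseteq> x" "\<And>s. s \<bullet> u \<sqsubseteq> x \<Longrightarrow> s \<le> t u" if "u \<in> U" for u
      using that by blast+
    have tdisj: "disjoint_from (t u \<bullet> u) (t v \<bullet> v)" if "u \<in> U" "v \<in> U" "u \<noteq> v" for u v
    proof -
      have "disjoint_from (t u \<bullet> u) v"
        using that Udisj Uprops t by (intro disjoint_scale) auto
      then show ?thesis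
        using that Uprops t disjoint_scale[of v "t u \<bullet> u" "t v"]
        by (simp add: disjoint_from_commute scale_nonneg)
    qed
    have xE: "x \<in> carrier E" using GE x by simp
    \<comment> \<open>The remainder after the largest multiples of the atoms are removed. It will
      turn out disjoint from all of \<open>U\<close>, hence zero by \<open>complete\<close>.\<close>
    define y where "y = x \<boxplus> (-1) \<bullet> lincomb t U"
    have lG: "lincomb t U \<in> G"
      unfolding lincomb_def using G U Gscale Uprops
      by (intro vsum_in_linear_subspace) (auto simp: riesz_subspace_def)
    then have yG: "y \<in> G" unfolding y_def by (intro Gadd Gscale x(1))
    have "lincomb t U \<sqsubseteq> x"
      unfolding lincomb_def using U Uprops t tdisj x xE scale_nonneg by (intro disjoint_vsum_le) auto
    then have y: "\<Zero> \<sqsubseteq> y" unfolding y_def using le_iff_diff[of "lincomb t U" x] xE UE by simp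
    have "disjoint_from y u" if u: "u \<in> U" for u
      unfolding disjoint_from_def
    proof (intro ballI impI)
      fix w assume w: "w \<in> carrier E" "w \<sqsubseteq> y" "w \<sqsubseteq> u"
      note c = Uprops(2)[OF u] GE[OF yG]
      \<comment> \<open>Below the atom \<open>u\<close> the meet must be a multiple
        \<open>s u\<close>. Since \<open>(t u + s) u\<close> still fits below \<open>x\<close>,
        maximality of \<open>t u\<close> gives \<open>s \<le> 0\<close>.\<close>
      have "y \<sqinter> u \<in> G" "\<Zero> \<sqsubseteq> y \<sqinter> u" "y \<sqinter> u \<sqsubseteq> u"
        using Gmeet[OF yG Uprops(1)[OF u]] meet_le[OF y Uprops(3)[OF u]] meet_right[of y u] c
        by simp_all
      then obtain s where s: "y \<sqinter> u = s \<bullet> u" using multiple[OF u] by blast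
      have "t u \<bullet> u \<sqsubseteq> lincomb t U"
        unfolding lincomb_def
        by (rule le_vsum) (use U Uprops t u in \<open>auto intro: scale_nonneg\<close>)
      moreover have "s \<bullet> u \<sqsubseteq> y" using meet_left[of y u] s c by simp
      ultimately have "(t u + s) \<bullet> u \<sqsubseteq> x"
        by (rule le_combination[of _ _ _ _ 1 1], use UE xE c in \<open>simp_all add: y_def\<close>)
          (rule lin3[of x u "lincomb t U"], use UE xE c in simp_all)
      then have "s \<le> 0" using t(3)[OF u] by fastforce
      have "w \<sqsubseteq> s \<bullet> u" using meet_le[of w y u] w c s by simp
      moreover have "s \<bullet> u \<sqsubseteq> 0 \<bullet> u"
        using \<open>s \<le> 0\<close> Uprops[OF u] by (intro scale_left_mono) auto
      ultimately show "w \<sqsubseteq> \<Zero>" using w c le_trans[of w "s \<bullet> u" \<Zero>] by simp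
    qed
    then have "y = \<Zero>" using complete yG y by blast
    then have "x \<boxplus> (-1) \<bullet> lincomb t U \<sqsubseteq> \<Zero>" unfolding y_def by simp
    then have "x \<sqsubseteq> lincomb t U"
      by (rule le_scaled[of _ _ 1], use xE UE in simp_all)
        (rule lin2[of x "lincomb t U"], use xE UE in simp_all)
    then show ?thesis using \<open>lincomb t U \<sqsubseteq> x\<close> xE UE le_antisym by (metis lincomb_closed)
  qed
  have "\<exists>c. x = lincomb c U" if x: "x \<in> G" for x
  proof -
    obtain c d where c: "pos_part x = lincomb c U" and d: "pos_part ((-1) \<bullet> x) = lincomb d U"
      using positive riesz_subspace_pos_part[OF G] Gscale GE x
      by (metis pos_part_nonneg scale_closed)
    have "x = lincomb (\<lambda>u. c u + (-1) * d u) U"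
      using pos_part_diff[OF GE[OF x]] unfolding c d
      using lincomb_add[OF U(1) UE] lincomb_scale[OF U(1) UE] by simp
    then show ?thesis by blast
  qed
  then show ?thesis using that U by blast
qed

end

section \<open>The order dual\<close>

lemma le_order_dual:
  "f \<sqsubseteq>\<^bsub>order_dual E\<^esub> g \<longleftrightarrow> (\<forall>x\<in>carrier E. \<Zero>\<^bsub>E\<^esub> \<sqsubseteq>\<^bsub>E\<^esub> x \<longrightarrow> f x \<le> g x)"
  and eq_order_dual: "f .=\<^bsub>order_dual E\<^esub> g \<longleftrightarrow> f = g"
  and add_order_dual: "f \<boxplus>\<^bsub>order_dual E\<^esub> g = (\<lambda>x\<in>carrier E. f x + g x)"
  and zero_order_dual: "\<Zero>\<^bsub>order_dual E\<^esub> = (\<lambda>x\<in>carrier E. 0)"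
  and scale_order_dual: "a \<bullet>\<^bsub>order_dual E\<^esub> f = (\<lambda>x\<in>carrier E. a * f x)"
  by (simp_all add: order_dual_def)

lemma carrier_order_dual_iff:
  "f \<in> carrier (order_dual E) \<longleftrightarrow> f \<in> extensional (carrier E) \<and> order_bounded_functional E f"
  by (simp add: order_dual_def)

lemma order_dual_add:
  "f \<in> carrier (order_dual E) \<Longrightarrow> x \<in> carrier E \<Longrightarrow> y \<in> carrier E \<Longrightarrow> f (x \<boxplus>\<^bsub>E\<^esub> y) = f x + f y"
  by (simp add: carrier_order_dual_iff order_bounded_functional_def)

lemma order_dual_scale:
  "f \<in> carrier (order_dual E) \<Longrightarrow> x \<in> carrier E \<Longrightarrow> f (a \<bullet>\<^bsub>E\<^esub> x) = a * f x"
  by (simp add: carrier_order_dual_iff order_bounded_functional_def)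

lemma order_dual_bounded:
  "f \<in> carrier (order_dual E) \<Longrightarrow> u \<in> carrier E \<Longrightarrow> v \<in> carrier E \<Longrightarrow>
    \<exists>M. \<forall>x\<in>carrier E. u \<sqsubseteq>\<^bsub>E\<^esub> x \<longrightarrow> x \<sqsubseteq>\<^bsub>E\<^esub> v \<longrightarrow> \<bar>f x\<bar> \<le> M"
  by (fastforce simp: carrier_order_dual_iff order_bounded_functional_def at_least_at_most_def)

lemma in_order_dualI:
  assumes "f \<in> extensional (carrier E)"
    and "\<And>x y. x \<in> carrier E \<Longrightarrow> y \<in> carrier E \<Longrightarrow> f (x \<boxplus>\<^bsub>E\<^esub> y) = f x + f y"
    and "\<And>a x. x \<in> carrier E \<Longrightarrow> f (a \<bullet>\<^bsub>E\<^esub> x) = a * f x"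
    and "\<And>u v. u \<in> carrier E \<Longrightarrow> v \<in> carrier E \<Longrightarrow>
      \<exists>M. \<forall>x\<in>carrier E. u \<sqsubseteq>\<^bsub>E\<^esub> x \<longrightarrow> x \<sqsubseteq>\<^bsub>E\<^esub> v \<longrightarrow> \<bar>f x\<bar> \<le> M"
  shows "f \<in> carrier (order_dual E)"
proof -
  have "\<exists>M. \<forall>x\<in>\<lbrace>u..v\<rbrace>\<^bsub>E\<^esub>. \<bar>f x\<bar> \<le> M" if "u \<in> carrier E" "v \<in> carrier E" for u v
    using assms(4)[OF that] by (auto simp: at_least_at_most_def)
  then show ?thesis
    using assms(1-3) by (simp add: carrier_order_dual_iff order_bounded_functional_def)
qed

lemma order_dual_eqI:
  assumes "f \<in> carrier (order_dual E)" "g \<in> carrier (order_dual E)"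
    and "\<And>x. x \<in> carrier E \<Longrightarrow> f x = g x"
  shows "f = g"
  using assms by (auto simp: carrier_order_dual_iff intro: extensionalityI)

section \<open>Positive functionals and the lattice structure of the dual\<close>

context riesz_space
begin

lemma order_dual_zero: "f \<in> carrier (order_dual E) \<Longrightarrow> f \<Zero> = 0"
  using order_dual_scale[of f E \<Zero> 0] by simp

lemma order_dual_mono:
  assumes "f \<in> carrier (order_dual E)" "\<And>x. x \<in> carrier E \<Longrightarrow> \<Zero> \<sqsubseteq> x \<Longrightarrow> 0 \<le> f x"
    "x \<in> carrier E" "y \<in> carrier E" "x \<sqsubseteq> y"
  shows "f x \<le> f y"
  using assms(2)[of "y \<boxplus> (-1) \<bullet> x"] assms le_iff_diff[of x y]
  by (simp add: order_dual_add order_dual_scale)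

text \<open>Positivity gives monotonicity, so on an order interval the values are controlled by
  those at its ends.\<close>

lemma in_order_dual_positiveI:
  assumes ext: "f \<in> extensional (carrier E)"
    and add: "\<And>x y. x \<in> carrier E \<Longrightarrow> y \<in> carrier E \<Longrightarrow> f (x \<boxplus> y) = f x + f y"
    and scale: "\<And>a x. x \<in> carrier E \<Longrightarrow> f (a \<bullet> x) = a * f x"
    and pos: "\<And>x. x \<in> carrier E \<Longrightarrow> \<Zero> \<sqsubseteq> x \<Longrightarrow> 0 \<le> f x"
  shows "f \<in> carrier (order_dual E)"
proof (rule in_order_dualI[OF ext add scale])
  fix u v assume uv: "u \<in> carrier E" "v \<in> carrier E"
  have mono: "f x \<le> f y" if "x \<in> carrier E" "y \<in> carrier E" "x \<sqsubseteq> y" for x y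
    using pos[of "y \<boxplus> (-1) \<bullet> x"] that le_iff_diff[of x y] by (simp add: add scale)
  have "\<bar>f x\<bar> \<le> \<bar>f u\<bar> + \<bar>f v\<bar>" if "x \<in> carrier E" "u \<sqsubseteq> x" "x \<sqsubseteq> v" for x
    using mono[of u x] mono[of x v] that uv by linarith
  then show "\<exists>M. \<forall>x\<in>carrier E. u \<sqsubseteq> x \<longrightarrow> x \<sqsubseteq> v \<longrightarrow> \<bar>f x\<bar> \<le> M" by blast
qed

lemma order_dual_add_closed:
  assumes "f \<in> carrier (order_dual E)" "g \<in> carrier (order_dual E)"
  shows "f \<boxplus>\<^bsub>order_dual E\<^esub> g \<in> carrier (order_dual E)"
  unfolding add_order_dual
proof (rule in_order_dualI)
  fix u v assume uv: "u \<in> carrier E" "v \<in> carrier E"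
  obtain M N where "\<forall>x\<in>carrier E. u \<sqsubseteq> x \<longrightarrow> x \<sqsubseteq> v \<longrightarrow> \<bar>f x\<bar> \<le> M"
    "\<forall>x\<in>carrier E. u \<sqsubseteq> x \<longrightarrow> x \<sqsubseteq> v \<longrightarrow> \<bar>g x\<bar> \<le> N"
    using order_dual_bounded[OF assms(1) uv] order_dual_bounded[OF assms(2) uv] by blast
  then have "\<forall>x\<in>carrier E. u \<sqsubseteq> x \<longrightarrow> x \<sqsubseteq> v \<longrightarrow> \<bar>(\<lambda>x\<in>carrier E. f x + g x) x\<bar> \<le> M + N"
    by (metis abs_triangle_ineq add_mono_thms_linordered_semiring(1) order_trans restrict_apply')
  then show "\<exists>M. \<forall>x\<in>carrier E. u \<sqsubseteq> x \<longrightarrow> x \<sqsubseteq> v \<longrightarrow> \<bar>(\<lambda>x\<in>carrier E. f x + g x) x\<bar> \<le> M"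
    by blast
qed (use assms in \<open>simp_all add: order_dual_add order_dual_scale algebra_simps\<close>)

lemma order_dual_scale_closed:
  assumes "f \<in> carrier (order_dual E)"
  shows "a \<bullet>\<^bsub>order_dual E\<^esub> f \<in> carrier (order_dual E)"
  unfolding scale_order_dual
proof (rule in_order_dualI)
  fix u v assume uv: "u \<in> carrier E" "v \<in> carrier E"
  obtain M where "\<forall>x\<in>carrier E. u \<sqsubseteq> x \<longrightarrow> x \<sqsubseteq> v \<longrightarrow> \<bar>f x\<bar> \<le> M"
    using order_dual_bounded[OF assms(1) uv] by blast
  then have "\<forall>x\<in>carrier E. u \<sqsubseteq> x \<longrightarrow> x \<sqsubseteq> v \<longrightarrow> \<bar>(\<lambda>x\<in>carrier E. a * f x) x\<bar> \<le> \<bar>a\<bar> * M"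
    by (simp add: abs_mult mult_left_mono)
  then show "\<exists>M. \<forall>x\<in>carrier E. u \<sqsubseteq> x \<longrightarrow> x \<sqsubseteq> v \<longrightarrow> \<bar>(\<lambda>x\<in>carrier E. a * f x) x\<bar> \<le> M"
    by blast
qed (use assms in \<open>simp_all add: order_dual_add order_dual_scale algebra_simps\<close>)

lemma order_dual_zero_closed: "\<Zero>\<^bsub>order_dual E\<^esub> \<in> carrier (order_dual E)"
  unfolding zero_order_dual by (rule in_order_dualI) auto

text \<open>Kantorovich's extension. Additivity on the cone makes \<open>p a - p b\<close>
  independent of the chosen representation \<open>a - b\<close> (this is \<open>diff\<close>), so
  linearity can be checked on whichever representation is convenient.\<close>

lemma positive_extension:
  fixes p :: "'a \<Rightarrow> real"
  assumes add: "\<And>x y. x \<in> carrier E \<Longrightarrow> y \<in> carrier E \<Longrightarrow> \<Zero> \<sqsubseteq> x \<Longrightarrow> \<Zero> \<sqsubseteq> y \<Longrightarrow> p (x \<boxplus> y) = p x + p y"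
    and scale: "\<And>a x. x \<in> carrier E \<Longrightarrow> \<Zero> \<sqsubseteq> x \<Longrightarrow> 0 \<le> a \<Longrightarrow> p (a \<bullet> x) = a * p x"
    and pos: "\<And>x. x \<in> carrier E \<Longrightarrow> \<Zero> \<sqsubseteq> x \<Longrightarrow> 0 \<le> p x"
  obtains g where "g \<in> carrier (order_dual E)" "\<And>x. x \<in> carrier E \<Longrightarrow> \<Zero> \<sqsubseteq> x \<Longrightarrow> g x = p x"
proof
  let ?g = "\<lambda>x\<in>carrier E. p (pos_part x) - p (pos_part ((-1) \<bullet> x))"
  have diff: "?g x = p a - p b"
    if "x = a \<boxplus> (-1) \<bullet> b" "a \<in> carrier E" "b \<in> carrier E" "\<Zero> \<sqsubseteq> a" "\<Zero> \<sqsubseteq> b" for x a b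
  proof -
    have x: "x \<in> carrier E" using that by simp
    let ?u = "pos_part x" and ?v = "pos_part ((-1) \<bullet> x)"
    have "?u \<boxplus> b = (?u \<boxplus> (-1) \<bullet> ?v) \<boxplus> (?v \<boxplus> b)"
      by (rule lin3[of ?u ?v b], use x that in simp_all)
    also have "\<dots> = (a \<boxplus> (-1) \<bullet> b) \<boxplus> (?v \<boxplus> b)"
      using pos_part_diff[OF x] that(1) by simp
    also have "\<dots> = a \<boxplus> ?v"
      by (rule lin3[of a ?v b], use x that in simp_all)
    finally have "p (?u \<boxplus> b) = p (a \<boxplus> ?v)" by simp
    then show ?thesis using x that by (simp add: add)
  qed
  show g: "?g x = p x" if "x \<in> carrier E" "\<Zero> \<sqsubseteq> x" for x
    using diff[of x x \<Zero>] scale[of \<Zero> 0] that by simp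
  show "?g \<in> carrier (order_dual E)"
  proof (rule in_order_dual_positiveI)
    fix x y assume c: "x \<in> carrier E" "y \<in> carrier E"
    let ?x = "pos_part x" and ?x' = "pos_part ((-1) \<bullet> x)"
    let ?y = "pos_part y" and ?y' = "pos_part ((-1) \<bullet> y)"
    have "x \<boxplus> y = (?x \<boxplus> (-1) \<bullet> ?x') \<boxplus> (?y \<boxplus> (-1) \<bullet> ?y')"
      using pos_part_diff c by simp
    also have "\<dots> = (?x \<boxplus> ?y) \<boxplus> (-1) \<bullet> (?x' \<boxplus> ?y')"
      by (rule lin4[of ?x ?x' ?y ?y'], use c in simp_all)
    finally show "?g (x \<boxplus> y) = ?g x + ?g y"
      using diff[of "x \<boxplus> y" "?x \<boxplus> ?y" "?x' \<boxplus> ?y'"] c by (simp add: add add_nonneg)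
  next
    fix a x assume c: "x \<in> carrier E"
    let ?x = "pos_part x" and ?x' = "pos_part ((-1) \<bullet> x)"
    have eq: "a \<bullet> x = a \<bullet> (?x \<boxplus> (-1) \<bullet> ?x')"
      using pos_part_diff c by simp
    show "?g (a \<bullet> x) = a * ?g x"
    proof (cases "0 \<le> a")
      case True
      have "a \<bullet> x = a \<bullet> ?x \<boxplus> (-1) \<bullet> (a \<bullet> ?x')"
        unfolding eq by (rule lin2[of ?x ?x'], use c in simp_all)
      then show ?thesis
        using diff[of "a \<bullet> x" "a \<bullet> ?x" "a \<bullet> ?x'"] c True
        by (simp add: scale scale_nonneg algebra_simps)
    next
      case False
      have "a \<bullet> x = (-a) \<bullet> ?x' \<boxplus> (-1) \<bullet> ((-a) \<bullet> ?x)"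
        unfolding eq by (rule lin2[of ?x ?x'], use c in simp_all)
      then show ?thesis
        using diff[of "a \<bullet> x" "(-a) \<bullet> ?x'" "(-a) \<bullet> ?x"] c False
        by (simp add: scale scale_nonneg algebra_simps)
    qed
  qed (use g pos in auto)
qed

text \<open>
  For \<open>I\<close> the whole positive cone this is the positive part of \<open>f\<close>; for \<open>I\<close> the cone
  generated by a positive vector \<open>w\<close> and \<open>0 \<le> f\<close> it is the component of \<open>f\<close> carried by \<open>w\<close>.
\<close>

lemma riesz_kantorovich:
  assumes f: "f \<in> carrier (order_dual E)"
    and I: "\<And>y. y \<in> I \<Longrightarrow> y \<in> carrier E \<and> \<Zero> \<sqsubseteq> y" "\<Zero> \<in> I"
      "\<And>x y. x \<in> I \<Longrightarrow> y \<in> I \<Longrightarrow> x \<boxplus> y \<in> I" "\<And>a x. x \<in> I \<Longrightarrow> 0 \<le> a \<Longrightarrow> a \<bullet> x \<in> I"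
      "\<And>x y. y \<in> I \<Longrightarrow> x \<in> carrier E \<Longrightarrow> \<Zero> \<sqsubseteq> x \<Longrightarrow> x \<sqsubseteq> y \<Longrightarrow> x \<in> I"
  obtains g where "g \<in> carrier (order_dual E)"
    "\<And>x. x \<in> carrier E \<Longrightarrow> \<Zero> \<sqsubseteq> x \<Longrightarrow> 0 \<le> g x"
    "\<And>x y. x \<in> carrier E \<Longrightarrow> y \<in> I \<Longrightarrow> y \<sqsubseteq> x \<Longrightarrow> f y \<le> g x"
    "\<And>x M. x \<in> carrier E \<Longrightarrow> \<Zero> \<sqsubseteq> x \<Longrightarrow> (\<And>y. y \<in> I \<Longrightarrow> y \<sqsubseteq> x \<Longrightarrow> f y \<le> M) \<Longrightarrow> g x \<le> M"
proof -
  \<comment> \<open>The Riesz-Kantorovich supremum, taken only over the members of \<open>I\<close>.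
    For positive \<open>x\<close> the set contains zero, and order boundedness of \<open>f\<close>
    makes the supremum finite.\<close>
  define p where "p x = Sup (f ` {y \<in> I. y \<sqsubseteq> x})" for x
  have upper: "f y \<le> p x" if xy: "x \<in> carrier E" "y \<in> I" "y \<sqsubseteq> x" for x y
  proof -
    obtain M where "\<forall>z\<in>carrier E. \<Zero> \<sqsubseteq> z \<longrightarrow> z \<sqsubseteq> x \<longrightarrow> \<bar>f z\<bar> \<le> M"
      using order_dual_bounded[OF f zero_closed xy(1)] by blast
    then have "\<forall>z\<in>I. z \<sqsubseteq> x \<longrightarrow> f z \<le> M" using I(1) by fastforce
    then have "bdd_above (f ` {y \<in> I. y \<sqsubseteq> x})" by (intro bdd_aboveI2[where M = M]) simp
    then show ?thesis unfolding p_def using xy by (intro cSup_upper) auto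
  qed
  have least: "p x \<le> M" if "\<Zero> \<sqsubseteq> x" "\<And>y. y \<in> I \<Longrightarrow> y \<sqsubseteq> x \<Longrightarrow> f y \<le> M" for x M
    unfolding p_def using that I(2) by (intro cSup_least) blast+
  have nonneg: "0 \<le> p x" if "x \<in> carrier E" "\<Zero> \<sqsubseteq> x" for x
    using upper[OF that(1) I(2) that(2)] order_dual_zero[OF f] by simp
  have add: "p (x \<boxplus> y) = p x + p y"
    if c: "x \<in> carrier E" "y \<in> carrier E" "\<Zero> \<sqsubseteq> x" "\<Zero> \<sqsubseteq> y" for x y
  proof (rule antisym)
    \<comment> \<open>A competitor \<open>z\<close> for the sum is split by
      \<open>riesz_decomposition\<close>; the pieces lie below \<open>z\<close> and therefore remain
      in \<open>I\<close>.\<close>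
    show "p (x \<boxplus> y) \<le> p x + p y"
    proof (rule least)
      show "\<Zero> \<sqsubseteq> x \<boxplus> y" using c by (simp add: add_nonneg)
      fix z assume z: "z \<in> I" "z \<sqsubseteq> x \<boxplus> y"
      have zc: "z \<in> carrier E" "\<Zero> \<sqsubseteq> z" using I(1)[OF z(1)] by auto
      obtain u v where uv: "u \<in> carrier E" "v \<in> carrier E" "\<Zero> \<sqsubseteq> u" "u \<sqsubseteq> x" "\<Zero> \<sqsubseteq> v" "v \<sqsubseteq> y" "u \<boxplus> v = z"
        using riesz_decomposition[OF zc(2) z(2) c(3,4,1,2) zc(1)] by blast
      have "u \<sqsubseteq> z" using le_add_right[of v u] uv by simp
      then have "u \<in> I" using I(5)[OF z(1)] uv by simp
      have "v \<sqsubseteq> z" using le_add_right[of u v] add_comm[of u v] uv by simp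
      then have "v \<in> I" using I(5)[OF z(1)] uv by simp
      then show "f z \<le> p x + p y"
        using upper[OF c(1) \<open>u \<in> I\<close> uv(4)] upper[OF c(2) \<open>v \<in> I\<close> uv(6)]
          order_dual_add[OF f uv(1,2)] uv(7) by simp
    qed
    have "f u + f v \<le> p (x \<boxplus> y)" if u: "u \<in> I" "u \<sqsubseteq> x" and v: "v \<in> I" "v \<sqsubseteq> y" for u v
      using upper[of "x \<boxplus> y" "u \<boxplus> v"] I(1)[OF u(1)] I(1)[OF v(1)] I(3) u v c add_le_add[of u x v y]
        order_dual_add[OF f, of u v] by simp
    then have "p x \<le> p (x \<boxplus> y) - f v" if v: "v \<in> I" "v \<sqsubseteq> y" for v
      using v by (intro least c(3)) (simp add: le_diff_eq)
    then have "p y \<le> p (x \<boxplus> y) - p x"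
      by (intro least c(4)) (simp add: le_diff_eq add.commute)
    then show "p x + p y \<le> p (x \<boxplus> y)" by simp
  qed
  \<comment> \<open>One inequality suffices: applied to \<open>1 / a\<close> and
    \<open>a \<bullet> x\<close> it yields the other.\<close>
  have scale_le: "a * p x \<le> p (a \<bullet> x)" if c: "x \<in> carrier E" "\<Zero> \<sqsubseteq> x" "0 < a" for a x
  proof -
    have "f y \<le> p (a \<bullet> x) / a" if y: "y \<in> I" "y \<sqsubseteq> x" for y
      using upper[of "a \<bullet> x" "a \<bullet> y"] y c I(1)[OF y(1)] I(4)[OF y(1), of a] scale_mono[of y x a]
        order_dual_scale[OF f, of y a]
      by (simp add: pos_le_divide_eq mult.commute)
    then have "p x \<le> p (a \<bullet> x) / a" by (intro least c(2))
    then show ?thesis using c by (simp add: pos_le_divide_eq mult.commute)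
  qed
  have scale: "p (a \<bullet> x) = a * p x" if c: "x \<in> carrier E" "\<Zero> \<sqsubseteq> x" "0 \<le> a" for a x
  proof (cases "a = 0")
    case True
    have "p \<Zero> = p \<Zero> + p \<Zero>" using add[of \<Zero> \<Zero>] by simp
    then show ?thesis using True c by simp
  next
    case False
    have "(1 / a) * p (a \<bullet> x) \<le> p ((1 / a) \<bullet> a \<bullet> x)"
      using c False by (intro scale_le) (simp_all add: scale_nonneg)
    then have "p (a \<bullet> x) \<le> a * p x"
      using c False by (simp add: scale_scale scale_one pos_divide_le_eq mult.commute)
    then show ?thesis using scale_le[of x a] c False by simp
  qed
  obtain g where g: "g \<in> carrier (order_dual E)" "\<And>x. x \<in> carrier E \<Longrightarrow> \<Zero> \<sqsubseteq> x \<Longrightarrow> g x = p x"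
    using positive_extension[of p] add scale nonneg by blast
  show ?thesis
  proof (rule that[OF g(1)])
    fix x y assume xy: "x \<in> carrier E" "y \<in> I" "y \<sqsubseteq> x"
    then have "\<Zero> \<sqsubseteq> x" using I(1)[of y] le_trans[of \<Zero> y x] by simp
    then show "f y \<le> g x" using upper xy g(2) by simp
  qed (use g(2) nonneg least in auto)
qed

text \<open>The case of the whole cone. The positive part is described by its bounds because the
  dual is not yet known to be a lattice.\<close>

lemma order_dual_pos_part:
  assumes f: "f \<in> carrier (order_dual E)"
  obtains g where "g \<in> carrier (order_dual E)"
    "\<And>x. x \<in> carrier E \<Longrightarrow> \<Zero> \<sqsubseteq> x \<Longrightarrow> 0 \<le> g x"
    "\<And>x. x \<in> carrier E \<Longrightarrow> \<Zero> \<sqsubseteq> x \<Longrightarrow> f x \<le> g x"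
    "\<And>x M. x \<in> carrier E \<Longrightarrow> \<Zero> \<sqsubseteq> x \<Longrightarrow>
      (\<And>y. y \<in> carrier E \<Longrightarrow> \<Zero> \<sqsubseteq> y \<Longrightarrow> y \<sqsubseteq> x \<Longrightarrow> f y \<le> M) \<Longrightarrow> g x \<le> M"
proof (rule riesz_kantorovich[OF f, of "{x \<in> carrier E. \<Zero> \<sqsubseteq> x}"])
  fix g assume g: "g \<in> carrier (order_dual E)"
    "\<And>x. x \<in> carrier E \<Longrightarrow> \<Zero> \<sqsubseteq> x \<Longrightarrow> 0 \<le> g x"
    "\<And>x y. x \<in> carrier E \<Longrightarrow> y \<in> {x \<in> carrier E. \<Zero> \<sqsubseteq> x} \<Longrightarrow> y \<sqsubseteq> x \<Longrightarrow> f y \<le> g x"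
    "\<And>x M. x \<in> carrier E \<Longrightarrow> \<Zero> \<sqsubseteq> x \<Longrightarrow>
      (\<And>y. y \<in> {x \<in> carrier E. \<Zero> \<sqsubseteq> x} \<Longrightarrow> y \<sqsubseteq> x \<Longrightarrow> f y \<le> M) \<Longrightarrow> g x \<le> M"
  show ?thesis
    by (rule that[OF g(1,2)]) (use g(3,4) in simp_all)
qed (simp_all add: add_nonneg scale_nonneg)

text \<open>The join is \<open>g\<close> plus the positive part of \<open>f - g\<close>.\<close>

lemma order_dual_join:
  assumes f: "f \<in> carrier (order_dual E)" and g: "g \<in> carrier (order_dual E)"
  obtains h where "h \<in> carrier (order_dual E)" "f \<sqsubseteq>\<^bsub>order_dual E\<^esub> h" "g \<sqsubseteq>\<^bsub>order_dual E\<^esub> h"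
    "\<And>k. k \<in> carrier (order_dual E) \<Longrightarrow> f \<sqsubseteq>\<^bsub>order_dual E\<^esub> k \<Longrightarrow> g \<sqsubseteq>\<^bsub>order_dual E\<^esub> k \<Longrightarrow>
      h \<sqsubseteq>\<^bsub>order_dual E\<^esub> k"
proof -
  let ?d = "f \<boxplus>\<^bsub>order_dual E\<^esub> (-1) \<bullet>\<^bsub>order_dual E\<^esub> g"
  have d: "?d \<in> carrier (order_dual E)"
    using f g by (intro order_dual_add_closed order_dual_scale_closed)
  obtain p where p: "p \<in> carrier (order_dual E)"
    "\<And>x. x \<in> carrier E \<Longrightarrow> \<Zero> \<sqsubseteq> x \<Longrightarrow> 0 \<le> p x"
    "\<And>x. x \<in> carrier E \<Longrightarrow> \<Zero> \<sqsubseteq> x \<Longrightarrow> ?d x \<le> p x"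
    "\<And>x M. x \<in> carrier E \<Longrightarrow> \<Zero> \<sqsubseteq> x \<Longrightarrow>
      (\<And>y. y \<in> carrier E \<Longrightarrow> \<Zero> \<sqsubseteq> y \<Longrightarrow> y \<sqsubseteq> x \<Longrightarrow> ?d y \<le> M) \<Longrightarrow> p x \<le> M"
    using order_dual_pos_part[OF d] by blast
  show ?thesis
  proof (rule that[of "g \<boxplus>\<^bsub>order_dual E\<^esub> p"])
    show "g \<boxplus>\<^bsub>order_dual E\<^esub> p \<in> carrier (order_dual E)"
      using g p by (intro order_dual_add_closed)
    show "f \<sqsubseteq>\<^bsub>order_dual E\<^esub> g \<boxplus>\<^bsub>order_dual E\<^esub> p"
      using p(3) by (fastforce simp: le_order_dual add_order_dual scale_order_dual)
    show "g \<sqsubseteq>\<^bsub>order_dual E\<^esub> g \<boxplus>\<^bsub>order_dual E\<^esub> p"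
      using p(2) by (simp add: le_order_dual add_order_dual)
    fix k assume k: "k \<in> carrier (order_dual E)" "f \<sqsubseteq>\<^bsub>order_dual E\<^esub> k" "g \<sqsubseteq>\<^bsub>order_dual E\<^esub> k"
    have kg: "k \<boxplus>\<^bsub>order_dual E\<^esub> (-1) \<bullet>\<^bsub>order_dual E\<^esub> g \<in> carrier (order_dual E)"
      using k g by (intro order_dual_add_closed order_dual_scale_closed)
    \<comment> \<open>The functional \<open>k - g\<close> is positive, hence monotone, and dominates
      \<open>f - g\<close>; so its value at \<open>x\<close> bounds \<open>f - g\<close> on all of
      \<open>[0, x]\<close>.\<close>
    have "p x \<le> k x - g x" if x: "x \<in> carrier E" "\<Zero> \<sqsubseteq> x" for x
    proof (rule p(4)[OF x])
      fix y assume y: "y \<in> carrier E" "\<Zero> \<sqsubseteq> y" "y \<sqsubseteq> x"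
      have "k y - g y \<le> k x - g x"
        using order_dual_mono[OF kg _ y(1) x(1) y(3)] k(3) x y
        by (simp add: le_order_dual add_order_dual scale_order_dual)
      then show "?d y \<le> k x - g x"
        using k(2) y by (fastforce simp: le_order_dual add_order_dual scale_order_dual)
    qed
    then show "g \<boxplus>\<^bsub>order_dual E\<^esub> p \<sqsubseteq>\<^bsub>order_dual E\<^esub> k"
      by (fastforce simp: le_order_dual add_order_dual)
  qed
qed

text \<open>The order of the dual sees only the positive cone; writing a vector as a difference of
  positive parts carries the equality to the whole space.\<close>

lemma order_dual_le_antisym:
  assumes fg: "f \<in> carrier (order_dual E)" "g \<in> carrier (order_dual E)"
    and le: "f \<sqsubseteq>\<^bsub>order_dual E\<^esub> g" "g \<sqsubseteq>\<^bsub>order_dual E\<^esub> f"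
  shows "f = g"
proof (rule order_dual_eqI[OF fg])
  fix x assume x: "x \<in> carrier E"
  have eq: "f y = g y" if "y \<in> carrier E" "\<Zero> \<sqsubseteq> y" for y
    using le that by (meson le_order_dual antisym)
  have split: "k x = k (pos_part x) - k (pos_part ((-1) \<bullet> x))" if "k \<in> carrier (order_dual E)" for k
    using arg_cong[OF pos_part_diff[OF x], of k] that x by (simp add: order_dual_add order_dual_scale)
  show "f x = g x"
    unfolding split[OF fg(1)] split[OF fg(2)] using eq x by simp
qed

theorem riesz_space_order_dual: "riesz_space (order_dual E)"
proof -
  let ?D = "order_dual E"
  note closed = order_dual_add_closed order_dual_scale_closed order_dual_zero_closed
  have ext: "f \<in> carrier ?D \<Longrightarrow> (\<lambda>x\<in>carrier E. f x) = f" for f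
    by (simp add: carrier_order_dual_iff extensional_restrict)
  interpret D: partial_order ?D
  proof unfold_locales
    show "(.=\<^bsub>?D\<^esub>) = (=)" by (simp add: fun_eq_iff eq_order_dual)
  qed (auto simp: eq_order_dual intro: order_dual_le_antisym, auto simp: le_order_dual intro: order_trans)
  interpret D: lattice ?D
  proof unfold_locales
    fix f g assume fg: "f \<in> carrier ?D" "g \<in> carrier ?D"
    obtain h where h: "h \<in> carrier ?D" "f \<sqsubseteq>\<^bsub>?D\<^esub> h" "g \<sqsubseteq>\<^bsub>?D\<^esub> h"
      "\<And>k. k \<in> carrier ?D \<Longrightarrow> f \<sqsubseteq>\<^bsub>?D\<^esub> k \<Longrightarrow> g \<sqsubseteq>\<^bsub>?D\<^esub> k \<Longrightarrow> h \<sqsubseteq>\<^bsub>?D\<^esub> k"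
      using order_dual_join[OF fg] by blast
    then show "\<exists>s. least ?D s (Upper ?D {f, g})"
      using fg by (intro exI[of _ h]) (auto simp: least_def Upper_def)
    \<comment> \<open>The meet, as \<open>f + g\<close> minus the join.\<close>
    let ?i = "(f \<boxplus>\<^bsub>?D\<^esub> g) \<boxplus>\<^bsub>?D\<^esub> (-1) \<bullet>\<^bsub>?D\<^esub> h"
    have i: "?i \<in> carrier ?D" using fg h(1) by (intro closed)
    have il: "?i \<sqsubseteq>\<^bsub>?D\<^esub> f" "?i \<sqsubseteq>\<^bsub>?D\<^esub> g"
      using h(2,3) by (fastforce simp: le_order_dual add_order_dual scale_order_dual)+
    have ig: "k \<sqsubseteq>\<^bsub>?D\<^esub> ?i" if k: "k \<in> carrier ?D" "k \<sqsubseteq>\<^bsub>?D\<^esub> f" "k \<sqsubseteq>\<^bsub>?D\<^esub> g" for k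
    proof -
      have "h \<sqsubseteq>\<^bsub>?D\<^esub> (f \<boxplus>\<^bsub>?D\<^esub> g) \<boxplus>\<^bsub>?D\<^esub> (-1) \<bullet>\<^bsub>?D\<^esub> k"
      proof (rule h(4))
        show "(f \<boxplus>\<^bsub>?D\<^esub> g) \<boxplus>\<^bsub>?D\<^esub> (-1) \<bullet>\<^bsub>?D\<^esub> k \<in> carrier ?D" using fg k by (intro closed)
      qed (use k in \<open>simp_all add: le_order_dual add_order_dual scale_order_dual\<close>)
      then show ?thesis by (fastforce simp: le_order_dual add_order_dual scale_order_dual)
    qed
    show "\<exists>s. greatest ?D s (Lower ?D {f, g})"
      using fg i il ig by (intro exI[of _ ?i]) (auto simp: greatest_def Lower_def)
  qed
  let ?G = "\<lparr>carrier = carrier ?D, monoid.mult = vadd ?D, one = vzero ?D\<rparr>"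
  have G: "comm_group ?G"
  proof (rule comm_groupI)
    fix f assume f: "f \<in> carrier ?G"
    show "\<exists>g\<in>carrier ?G. g \<otimes>\<^bsub>?G\<^esub> f = \<one>\<^bsub>?G\<^esub>"
      using f closed(2)[of f "-1"] by (intro bexI[of _ "(-1) \<bullet>\<^bsub>?D\<^esub> f"])
        (auto simp: add_order_dual scale_order_dual zero_order_dual intro!: restrict_ext)
    show "\<one>\<^bsub>?G\<^esub> \<otimes>\<^bsub>?G\<^esub> f = f"
      using ext[of f] f by (auto simp: add_order_dual zero_order_dual cong: restrict_cong)
  qed (auto simp: closed, auto simp: add_order_dual intro!: restrict_ext)
  show ?thesis
  proof (intro riesz_space.intro D.lattice_axioms riesz_space_axioms.intro G)
    fix f assume "f \<in> carrier ?D"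
    then show "1 \<bullet>\<^bsub>?D\<^esub> f = f" using ext by (simp add: scale_order_dual)
  qed (auto simp: closed, auto simp: add_order_dual scale_order_dual zero_order_dual le_order_dual
      algebra_simps intro!: restrict_ext)
qed

end

section \<open>Riesz functionals and the bidual\<close>

text \<open>These are the lattice homomorphisms into the reals, expressed by absolute values as for
  multimorphisms.\<close>

definition riesz_functional :: "('a, 'c) riesz_scheme \<Rightarrow> ('a \<Rightarrow> real) \<Rightarrow> bool" where
  "riesz_functional E h \<longleftrightarrow>
    h \<in> carrier (order_dual E) \<and> (\<forall>x\<in>carrier E. h (vabs E x) = \<bar>h x\<bar>)"

context riesz_space
begin

lemma riesz_functionalI:
  assumes ext: "h \<in> extensional (carrier E)"
    and add: "\<And>x y. x \<in> carrier E \<Longrightarrow> y \<in> carrier E \<Longrightarrow> h (x \<boxplus> y) = h x + h y"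
    and scale: "\<And>a x. x \<in> carrier E \<Longrightarrow> h (a \<bullet> x) = a * h x"
    and abs: "\<And>x. x \<in> carrier E \<Longrightarrow> h (vabs E x) = \<bar>h x\<bar>"
  shows "riesz_functional E h"
proof -
  have "0 \<le> h x" if "x \<in> carrier E" "\<Zero> \<sqsubseteq> x" for x
    using abs[OF that(1)] vabs_of_nonneg[OF that(2,1)] by simp
  then show ?thesis
    using in_order_dual_positiveI[OF ext add scale] abs by (simp add: riesz_functional_def)
qed

lemma riesz_functional_nonneg:
  "riesz_functional E h \<Longrightarrow> x \<in> carrier E \<Longrightarrow> \<Zero> \<sqsubseteq> x \<Longrightarrow> 0 \<le> h x"
  using vabs_of_nonneg[of x] unfolding riesz_functional_def by (metis abs_ge_zero)

lemma riesz_functional_zero: "riesz_functional E \<Zero>\<^bsub>order_dual E\<^esub>"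
  by (rule riesz_functionalI) (simp_all add: zero_order_dual)

text \<open>If \<open>h x = 0\<close> then \<open>h\<close> also vanishes at the absolute value of
  \<open>x\<close>, so \<open>g\<close> vanishes there and at \<open>x\<close>. Functionals with
  nested kernels are proportional, and the ratio is read off at a positive vector
  \<open>e\<close>.\<close>

lemma dominated_by_riesz_functional:
  assumes h: "riesz_functional E h" and g: "g \<in> carrier (order_dual E)"
    and nonneg: "\<And>x. x \<in> carrier E \<Longrightarrow> \<Zero> \<sqsubseteq> x \<Longrightarrow> 0 \<le> g x"
    and le: "\<And>x. x \<in> carrier E \<Longrightarrow> \<Zero> \<sqsubseteq> x \<Longrightarrow> g x \<le> h x"
  obtains t where "0 \<le> t" "t \<le> 1" "\<And>x. x \<in> carrier E \<Longrightarrow> g x = t * h x"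
proof -
  have hD: "h \<in> carrier (order_dual E)" and habs: "\<And>x. x \<in> carrier E \<Longrightarrow> h (vabs E x) = \<bar>h x\<bar>"
    using h by (simp_all add: riesz_functional_def)
  have ker: "g x = 0" if x: "x \<in> carrier E" "h x = 0" for x
  proof -
    have 0: "g (vabs E x) \<le> 0" using le[of "vabs E x"] x habs[OF x(1)] by simp
    have "g x \<le> g (vabs E x)"
      using x by (intro order_dual_mono[OF g nonneg] vabs_ge) simp_all
    moreover have "g ((-1) \<bullet> x) \<le> g (vabs E x)"
      using x by (intro order_dual_mono[OF g nonneg] vabs_ge_neg) simp_all
    ultimately show ?thesis using 0 order_dual_scale[OF g x(1), of "-1"] by linarith
  qed
  show ?thesis
  proof (cases "\<exists>x\<in>carrier E. h x \<noteq> 0")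
    case False
    then show ?thesis using ker that[of 0] by simp
  next
    case True
    then obtain x where x: "x \<in> carrier E" "h x \<noteq> 0" by blast
    define e where "e = vabs E x"
    have e: "e \<in> carrier E" "\<Zero> \<sqsubseteq> e" "0 < h e"
      using x habs[OF x(1)] by (simp_all add: e_def)
    have multiple: "g y = (g e / h e) * h y" if y: "y \<in> carrier E" for y
    proof -
      let ?s = "y \<boxplus> (- (h y / h e)) \<bullet> e"
      have "h ?s = 0" using hD y e by (simp add: order_dual_add order_dual_scale)
      then have "g ?s = 0" using ker y e by simp
      then show ?thesis using g y e by (simp add: order_dual_add order_dual_scale field_simps)
    qed
    show ?thesis
      using nonneg[OF e(1,2)] le[OF e(1,2)] e(3) multiple that[of "g e / h e"] by simp
  qed
qed

lemma vabs_bidual_riesz_functional: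
  assumes z: "z \<in> carrier (order_bidual E)" and h: "riesz_functional E h"
  shows "vabs (order_bidual E) z h = \<bar>z h\<bar>"
proof -
  interpret D: riesz_space "order_dual E" by (rule riesz_space_order_dual)
  interpret B: riesz_space "order_bidual E" by (rule D.riesz_space_order_dual)
  have hD: "h \<in> carrier (order_dual E)" using h by (simp add: riesz_functional_def)
  have h0: "\<Zero>\<^bsub>order_dual E\<^esub> \<sqsubseteq>\<^bsub>order_dual E\<^esub> h"
    using riesz_functional_nonneg[OF h] by (simp add: le_order_dual zero_order_dual)
  have "z h \<le> vabs (order_bidual E) z h"
    using B.vabs_ge[OF z] hD h0 by (simp add: le_order_dual[of "order_dual E"])
  moreover have "- z h \<le> vabs (order_bidual E) z h"
    using B.vabs_ge_neg[OF z] hD h0 by (simp add: le_order_dual[of "order_dual E"] scale_order_dual)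
  moreover have "vabs (order_bidual E) z h \<le> \<bar>z h\<bar>"
  proof -
    obtain p where p: "p \<in> carrier (order_bidual E)"
      "\<And>f. f \<in> carrier (order_dual E) \<Longrightarrow> \<Zero>\<^bsub>order_dual E\<^esub> \<sqsubseteq>\<^bsub>order_dual E\<^esub> f \<Longrightarrow> 0 \<le> p f"
      "\<And>f. f \<in> carrier (order_dual E) \<Longrightarrow> \<Zero>\<^bsub>order_dual E\<^esub> \<sqsubseteq>\<^bsub>order_dual E\<^esub> f \<Longrightarrow> z f \<le> p f"
      "\<And>f M. f \<in> carrier (order_dual E) \<Longrightarrow> \<Zero>\<^bsub>order_dual E\<^esub> \<sqsubseteq>\<^bsub>order_dual E\<^esub> f \<Longrightarrow>
        (\<And>g. g \<in> carrier (order_dual E) \<Longrightarrow> \<Zero>\<^bsub>order_dual E\<^esub> \<sqsubseteq>\<^bsub>order_dual E\<^esub> g \<Longrightarrow>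
          g \<sqsubseteq>\<^bsub>order_dual E\<^esub> f \<Longrightarrow> z g \<le> M) \<Longrightarrow> p f \<le> M"
      using D.order_dual_pos_part[OF z] by blast
    \<comment> \<open>With \<open>p\<close> the positive part of \<open>z\<close>, this is the
      expression of the absolute value as twice the positive part minus \<open>z\<close>; here it
      serves as an upper bound.\<close>
    let ?w = "2 \<bullet>\<^bsub>order_bidual E\<^esub> p \<boxplus>\<^bsub>order_bidual E\<^esub> (-1) \<bullet>\<^bsub>order_bidual E\<^esub> z"
    have w: "?w \<in> carrier (order_bidual E)" using p(1) z by simp
    have "vabs (order_bidual E) z \<sqsubseteq>\<^bsub>order_bidual E\<^esub> ?w"
    proof (rule B.vabs_least[OF _ _ z w])
      show "z \<sqsubseteq>\<^bsub>order_bidual E\<^esub> ?w"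
        unfolding le_order_dual[of "order_dual E"] add_order_dual scale_order_dual
        using p(3) by fastforce
      show "(-1) \<bullet>\<^bsub>order_bidual E\<^esub> z \<sqsubseteq>\<^bsub>order_bidual E\<^esub> ?w"
        unfolding le_order_dual[of "order_dual E"] add_order_dual scale_order_dual
        using p(2) by fastforce
    qed
    then have "vabs (order_bidual E) z h \<le> 2 * p h - z h"
      using hD h0 by (simp add: le_order_dual[of "order_dual E"] add_order_dual scale_order_dual)
    \<comment> \<open>The competitors for \<open>p h\<close> are the multiples \<open>t h\<close>
      with \<open>t\<close> between 0 and 1, at which \<open>z\<close> has the value
      \<open>t * z h\<close>.\<close>
    moreover have "p h \<le> max (z h) 0"
    proof (rule p(4)[OF hD h0])
      fix g assume g: "g \<in> carrier (order_dual E)" "\<Zero>\<^bsub>order_dual E\<^esub> \<sqsubseteq>\<^bsub>order_dual E\<^esub> g"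
        "g \<sqsubseteq>\<^bsub>order_dual E\<^esub> h"
      obtain t where t: "0 \<le> t" "t \<le> 1" "\<And>x. x \<in> carrier E \<Longrightarrow> g x = t * h x"
        using dominated_by_riesz_functional[OF h g(1)] g(2,3)
        by (auto simp: le_order_dual zero_order_dual)
      have "g = t \<bullet>\<^bsub>order_dual E\<^esub> h"
        using g(1) hD t(3) by (intro order_dual_eqI[OF g(1)] order_dual_scale_closed)
          (simp_all add: scale_order_dual)
      then have "z g = t * z h" using order_dual_scale[OF z hD] by simp
      moreover have "t * z h \<le> max (z h) 0"
      proof (cases "0 \<le> z h")
        case True
        then show ?thesis using t(2) mult_right_mono[of t 1 "z h"] by simp
      next
        case False
        then show ?thesis using t(1) by (simp add: mult_nonneg_nonpos)
      qed
      ultimately show "z g \<le> max (z h) 0" by simp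
    qed
    ultimately show ?thesis by (simp add: abs_if max_def split: if_splits)
  qed
  ultimately show ?thesis by linarith
qed

section \<open>The canonical map into the bidual\<close>

definition evaluation :: "'a \<Rightarrow> ('a \<Rightarrow> real) \<Rightarrow> real" where
  "evaluation v = (\<lambda>f\<in>carrier (order_dual E). f v)"

lemma evaluation_closed:
  assumes v: "v \<in> carrier E"
  shows "evaluation v \<in> carrier (order_bidual E)"
  unfolding evaluation_def
proof (rule in_order_dualI)
  fix f g assume fg: "f \<in> carrier (order_dual E)" "g \<in> carrier (order_dual E)"
  let ?p = "pos_part v" and ?n = "pos_part ((-1) \<bullet> v)"
  let ?M = "\<bar>f ?p\<bar> + \<bar>g ?p\<bar> + \<bar>f ?n\<bar> + \<bar>g ?n\<bar>"
  have "\<bar>k v\<bar> \<le> ?M"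
    if k: "k \<in> carrier (order_dual E)" "f \<sqsubseteq>\<^bsub>order_dual E\<^esub> k" "k \<sqsubseteq>\<^bsub>order_dual E\<^esub> g" for k
  proof -
    have "k v = k ?p - k ?n"
      using arg_cong[OF pos_part_diff[OF v], of k] k v by (simp add: order_dual_add order_dual_scale)
    moreover have "f ?p \<le> k ?p" "k ?p \<le> g ?p" "f ?n \<le> k ?n" "k ?n \<le> g ?n"
      using k(2,3) v by (simp_all add: le_order_dual)
    ultimately show ?thesis by linarith
  qed
  then show "\<exists>M. \<forall>k\<in>carrier (order_dual E). f \<sqsubseteq>\<^bsub>order_dual E\<^esub> k \<longrightarrow> k \<sqsubseteq>\<^bsub>order_dual E\<^esub> g \<longrightarrow>
      \<bar>(\<lambda>f\<in>carrier (order_dual E). f v) k\<bar> \<le> M"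
    by (intro exI[of _ ?M]) simp
qed (use v order_dual_add_closed order_dual_scale_closed in
    \<open>simp_all add: add_order_dual scale_order_dual\<close>)

text \<open>\<open>g\<close> is the component of \<open>f\<close> carried by the positive part of
  \<open>v\<close>: it agrees with \<open>f\<close> there and vanishes on the negative part. Thus
  \<open>2g - f\<close>, which lies between \<open>-f\<close> and \<open>f\<close>, attains at
  \<open>v\<close> the value of \<open>f\<close> at the absolute value of \<open>v\<close>.\<close>

lemma functional_attaining_vabs:
  assumes f: "f \<in> carrier (order_dual E)" "\<And>x. x \<in> carrier E \<Longrightarrow> \<Zero> \<sqsubseteq> x \<Longrightarrow> 0 \<le> f x"
    and v: "v \<in> carrier E"
  obtains g where "g \<in> carrier (order_dual E)"
    "\<And>x. x \<in> carrier E \<Longrightarrow> \<Zero> \<sqsubseteq> x \<Longrightarrow> 0 \<le> g x" "\<And>x. x \<in> carrier E \<Longrightarrow> \<Zero> \<sqsubseteq> x \<Longrightarrow> g x \<le> f x"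
    "2 * g v - f v = f (vabs E v)"
proof -
  let ?p = "pos_part v" and ?n = "pos_part ((-1) \<bullet> v)"
  \<comment> \<open>The positive cone of the principal ideal generated by \<open>?p\<close>.\<close>
  let ?I = "{y \<in> carrier E. \<Zero> \<sqsubseteq> y \<and> (\<exists>s\<ge>0. y \<sqsubseteq> s \<bullet> ?p)}"
  have p: "?p \<in> carrier E" "\<Zero> \<sqsubseteq> ?p" and n: "?n \<in> carrier E" "\<Zero> \<sqsubseteq> ?n" using v by simp_all
  obtain g where g: "g \<in> carrier (order_dual E)"
    "\<And>x. x \<in> carrier E \<Longrightarrow> \<Zero> \<sqsubseteq> x \<Longrightarrow> 0 \<le> g x"
    "\<And>x y. x \<in> carrier E \<Longrightarrow> y \<in> ?I \<Longrightarrow> y \<sqsubseteq> x \<Longrightarrow> f y \<le> g x"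
    "\<And>x M. x \<in> carrier E \<Longrightarrow> \<Zero> \<sqsubseteq> x \<Longrightarrow> (\<And>y. y \<in> ?I \<Longrightarrow> y \<sqsubseteq> x \<Longrightarrow> f y \<le> M) \<Longrightarrow> g x \<le> M"
  proof (rule riesz_kantorovich[OF f(1), of ?I])
    show "\<Zero> \<in> ?I" using p by (simp, intro exI[of _ 0]) simp
  next
    fix x y assume x: "x \<in> ?I" and y: "y \<in> ?I"
    then obtain s t where st: "0 \<le> s" "x \<sqsubseteq> s \<bullet> ?p" "0 \<le> t" "y \<sqsubseteq> t \<bullet> ?p" by blast
    then have "x \<boxplus> y \<sqsubseteq> (s + t) \<bullet> ?p"
      using x y p(1) add_le_add[of x "s \<bullet> ?p" y "t \<bullet> ?p"] by (simp add: scale_add_left)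
    then show "x \<boxplus> y \<in> ?I"
      using x y st by (simp add: add_nonneg) (intro exI[of _ "s + t"], simp)
  next
    fix a :: real and x assume x: "x \<in> ?I" and a: "0 \<le> a"
    then obtain s where s: "0 \<le> s" "x \<sqsubseteq> s \<bullet> ?p" by blast
    then have "a \<bullet> x \<sqsubseteq> (a * s) \<bullet> ?p"
      using scale_mono[OF s(2) a] x p(1) by (simp add: scale_scale)
    then show "a \<bullet> x \<in> ?I"
      using x a s by (simp add: scale_nonneg) (intro exI[of _ "a * s"], simp)
  next
    fix x y assume y: "y \<in> ?I" and x: "x \<in> carrier E" "\<Zero> \<sqsubseteq> x" "x \<sqsubseteq> y"
    then obtain s where s: "0 \<le> s" "y \<sqsubseteq> s \<bullet> ?p" by blast
    have "x \<sqsubseteq> s \<bullet> ?p" using le_trans[OF x(3) s(2)] x y p(1) by simp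
    then show "x \<in> ?I" using x s by blast
  qed blast+
  have le: "g x \<le> f x" if x: "x \<in> carrier E" "\<Zero> \<sqsubseteq> x" for x
    using x by (intro g(4)[OF x] order_dual_mono[OF f]) auto
  have "?p \<in> ?I" using p by (simp, intro exI[of _ 1]) (simp add: scale_one)
  then have "f ?p \<le> g ?p" using g(3)[of ?p ?p] p by simp
  then have gp: "g ?p = f ?p" using le[OF p] by simp
  \<comment> \<open>A member of \<open>?I\<close> below \<open>?n\<close> also lies below a multiple
    of \<open>?p\<close>, which is disjoint from \<open>?n\<close>; so only zero competes.\<close>
  have "g ?n \<le> 0"
  proof (rule g(4)[OF n])
    fix y assume y: "y \<in> ?I" "y \<sqsubseteq> ?n"
    then obtain s where s: "0 \<le> s" "y \<sqsubseteq> s \<bullet> ?p" by blast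
    have "disjoint_from (s \<bullet> ?p) ?n"
      using disjoint_pos_parts[OF v] p n s by (intro disjoint_scale) simp_all
    then have "y \<sqsubseteq> \<Zero>" using y s by (simp add: disjoint_from_def)
    then have "y = \<Zero>" using y by (simp add: le_antisym)
    then show "f y \<le> 0" using order_dual_zero[OF f(1)] by simp
  qed
  then have gn: "g ?n = 0" using g(2)[OF n] by simp
  have split: "k v = k ?p - k ?n" "k (vabs E v) = k ?p + k ?n" if "k \<in> carrier (order_dual E)" for k
    using arg_cong[OF pos_part_diff[OF v], of k] arg_cong[OF pos_part_add[OF v], of k] that p n
    by (simp_all add: order_dual_add order_dual_scale)
  have "2 * g v - f v = f (vabs E v)"
    unfolding split(1)[OF g(1)] split[OF f(1)] gp gn by simp
  then show ?thesis using that g(1,2) le by blast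
qed

text \<open>The substance is leastness. A positive \<open>f\<close> is split as
  \<open>g + (f - g)\<close> with \<open>g\<close> from \<open>functional_attaining_vabs\<close>.
  Testing an upper bound \<open>w\<close> with \<open>v\<close> at \<open>g\<close> and with
  \<open>-v\<close> at \<open>f - g\<close>, and adding, gives
  \<open>2 * g v - f v \<le> w f\<close>.\<close>

lemma vabs_evaluation:
  assumes v: "v \<in> carrier E"
  shows "vabs (order_bidual E) (evaluation v) = evaluation (vabs E v)"
proof -
  interpret D: riesz_space "order_dual E" by (rule riesz_space_order_dual)
  interpret B: riesz_space "order_bidual E" by (rule D.riesz_space_order_dual)
  have nonneg: "0 \<le> f x"
    if "f \<in> carrier (order_dual E)" "\<Zero>\<^bsub>order_dual E\<^esub> \<sqsubseteq>\<^bsub>order_dual E\<^esub> f" "x \<in> carrier E" "\<Zero> \<sqsubseteq> x"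
    for f x
    using that by (simp add: le_order_dual zero_order_dual)
  show ?thesis
  proof (rule B.vabs_eqI)
    have "f v \<le> f (vabs E v)"
      if "f \<in> carrier (order_dual E)" "\<Zero>\<^bsub>order_dual E\<^esub> \<sqsubseteq>\<^bsub>order_dual E\<^esub> f" for f
      using v order_dual_mono[OF that(1) nonneg[OF that] _ _ vabs_ge[OF v]] by simp
    then show "evaluation v \<sqsubseteq>\<^bsub>order_bidual E\<^esub> evaluation (vabs E v)"
      by (simp add: le_order_dual[of "order_dual E"] evaluation_def)
    have "- f v \<le> f (vabs E v)"
      if "f \<in> carrier (order_dual E)" "\<Zero>\<^bsub>order_dual E\<^esub> \<sqsubseteq>\<^bsub>order_dual E\<^esub> f" for f
      using v order_dual_mono[OF that(1) nonneg[OF that] _ _ vabs_ge_neg[OF v]] that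
      by (simp add: order_dual_scale)
    then show "(-1) \<bullet>\<^bsub>order_bidual E\<^esub> evaluation v \<sqsubseteq>\<^bsub>order_bidual E\<^esub> evaluation (vabs E v)"
      by (simp add: le_order_dual[of "order_dual E"] evaluation_def scale_order_dual)
    fix w assume w: "w \<in> carrier (order_bidual E)" "evaluation v \<sqsubseteq>\<^bsub>order_bidual E\<^esub> w"
      "(-1) \<bullet>\<^bsub>order_bidual E\<^esub> evaluation v \<sqsubseteq>\<^bsub>order_bidual E\<^esub> w"
    have wge: "k v \<le> w k" "- k v \<le> w k"
      if "k \<in> carrier (order_dual E)" "\<Zero>\<^bsub>order_dual E\<^esub> \<sqsubseteq>\<^bsub>order_dual E\<^esub> k" for k
      using w(2,3) that by (simp_all add: le_order_dual[of "order_dual E"] evaluation_def scale_order_dual)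
    have "f (vabs E v) \<le> w f"
      if f: "f \<in> carrier (order_dual E)" "\<Zero>\<^bsub>order_dual E\<^esub> \<sqsubseteq>\<^bsub>order_dual E\<^esub> f" for f
    proof -
      obtain g where g: "g \<in> carrier (order_dual E)"
        "\<And>x. x \<in> carrier E \<Longrightarrow> \<Zero> \<sqsubseteq> x \<Longrightarrow> 0 \<le> g x" "\<And>x. x \<in> carrier E \<Longrightarrow> \<Zero> \<sqsubseteq> x \<Longrightarrow> g x \<le> f x"
        "2 * g v - f v = f (vabs E v)"
        using functional_attaining_vabs[OF f(1) nonneg[OF f] v] by blast
      let ?k = "f \<boxplus>\<^bsub>order_dual E\<^esub> (-1) \<bullet>\<^bsub>order_dual E\<^esub> g"
      have "?k \<in> carrier (order_dual E)" using f(1) g(1) by simp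
      moreover have "\<Zero>\<^bsub>order_dual E\<^esub> \<sqsubseteq>\<^bsub>order_dual E\<^esub> ?k"
        using g(3) by (simp add: le_order_dual zero_order_dual add_order_dual scale_order_dual)
      ultimately have "- ?k v \<le> w ?k" by (rule wge(2))
      moreover have "w ?k = w f - w g"
        using order_dual_add[OF w(1), of f "(-1) \<bullet>\<^bsub>order_dual E\<^esub> g"] order_dual_scale[OF w(1), of g "-1"]
          f(1) g(1) by simp
      moreover have "g v \<le> w g"
        using g by (intro wge(1)) (simp_all add: le_order_dual zero_order_dual)
      ultimately show ?thesis using g(4) v by (simp add: add_order_dual scale_order_dual)
    qed
    then show "evaluation (vabs E v) \<sqsubseteq>\<^bsub>order_bidual E\<^esub> w"
      by (simp add: le_order_dual[of "order_dual E"] evaluation_def)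
  qed (use v in \<open>simp_all add: evaluation_closed\<close>)
qed

end

section \<open>Real-valued multimorphisms\<close>

lemma fun_upd_in_points:
  "x \<in> points I E \<Longrightarrow> i \<in> I \<Longrightarrow> u \<in> carrier (E i) \<Longrightarrow> x(i := u) \<in> points I E"
  using PiE_fun_upd[of u "\<lambda>i. carrier (E i)" i x I] by (simp add: insert_absorb)

lemma points_carrier: "x \<in> points I E \<Longrightarrow> i \<in> I \<Longrightarrow> x i \<in> carrier (E i)"
  by (rule PiE_mem)

text \<open>
  Freezing all arguments but one at positive vectors leaves a Riesz functional, and enlarging the
  frozen arguments only rescales it, because the functionals dominated by a Riesz functional are
  its multiples.
\<close>

theorem real_multimorphism_product:
  fixes E :: "nat \<Rightarrow> 'a riesz" and \<phi> :: "(nat \<Rightarrow> 'a) \<Rightarrow> real"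
  assumes I: "finite I" and E: "\<And>i. i \<in> I \<Longrightarrow> riesz_space (E i)"
    and add: "\<And>x i u v. x \<in> points I E \<Longrightarrow> i \<in> I \<Longrightarrow> u \<in> carrier (E i) \<Longrightarrow> v \<in> carrier (E i) \<Longrightarrow>
      \<phi> (x(i := u \<boxplus>\<^bsub>E i\<^esub> v)) = \<phi> (x(i := u)) + \<phi> (x(i := v))"
    and scale: "\<And>x i a u. x \<in> points I E \<Longrightarrow> i \<in> I \<Longrightarrow> u \<in> carrier (E i) \<Longrightarrow>
      \<phi> (x(i := a \<bullet>\<^bsub>E i\<^esub> u)) = a * \<phi> (x(i := u))"
    and abs: "\<And>x. x \<in> points I E \<Longrightarrow> \<bar>\<phi> x\<bar> = \<phi> (\<lambda>i\<in>I. vabs (E i) (x i))"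
  shows "\<exists>\<kappa> h. 0 \<le> \<kappa> \<and> (\<forall>i\<in>I. riesz_functional (E i) (h i)) \<and>
    (\<forall>x\<in>points I E. \<phi> x = \<kappa> * (\<Prod>i\<in>I. h i (x i)))"
proof (cases "\<exists>x\<in>points I E. \<phi> x \<noteq> 0")
  case False
  then show ?thesis
    using riesz_space.riesz_functional_zero[OF E]
    by (intro exI[of _ 0] exI[of _ "\<lambda>i. \<Zero>\<^bsub>order_dual (E i)\<^esub>"]) simp
next
  case True
  define positive where "positive x \<longleftrightarrow> x \<in> points I E \<and> (\<forall>i\<in>I. \<Zero>\<^bsub>E i\<^esub> \<sqsubseteq>\<^bsub>E i\<^esub> x i)" for x
  define vabs_pt where "vabs_pt x = (\<lambda>i\<in>I. vabs (E i) (x i))" for x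
  have vabs_pt: "positive (vabs_pt x)" if "x \<in> points I E" for x
    using that riesz_space.vabs_closed[OF E] riesz_space.vabs_nonneg[OF E] points_carrier[OF that]
    by (simp add: positive_def vabs_pt_def)
  have vabs_pt_positive: "vabs_pt x = x" if "positive x" for x
    using that riesz_space.vabs_of_nonneg[OF E] unfolding positive_def vabs_pt_def
    by (intro extensionalityI[of _ I]) (auto simp: PiE_iff)
  \<comment> \<open>The modulus acts on all arguments at once, but leaves the positive ones
    unchanged, so only argument \<open>i\<close> is affected.\<close>
  have abs_upd: "\<phi> (x(i := vabs (E i) t)) = \<bar>\<phi> (x(i := t))\<bar>"
    if x: "positive x" and i: "i \<in> I" and t: "t \<in> carrier (E i)" for x i t
  proof -
    have "x \<in> points I E" using x by (simp add: positive_def)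
    moreover have "vabs_pt (x(i := t)) = (vabs_pt x)(i := vabs (E i) t)"
      using i by (auto simp: vabs_pt_def fun_eq_iff restrict_def)
    then have "vabs_pt (x(i := t)) = x(i := vabs (E i) t)"
      unfolding vabs_pt_positive[OF x] .
    ultimately show ?thesis
      using abs[of "x(i := t)"] fun_upd_in_points[of x I E i t] i t by (simp add: vabs_pt_def)
  qed
  \<comment> \<open>The factor \<open>c\<close> is 1 for plain slices and
    \<open>1 / \<phi> a\<close> for the normalised functionals \<open>h\<close>.\<close>
  have slice: "riesz_functional (E i) (\<lambda>t\<in>carrier (E i). c * \<phi> (x(i := t)))"
    if x: "positive x" and i: "i \<in> I" and c: "0 \<le> c" for x i c
  proof -
    interpret Ei: riesz_space "E i" by (rule E[OF i])
    have "x \<in> points I E" using x by (simp add: positive_def)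
    then show ?thesis
      using add scale abs_upd[OF x i] i c
      by (intro Ei.riesz_functionalI) (simp_all add: abs_mult algebra_simps)
  qed
  have nonneg: "0 \<le> \<phi> x" if "positive x" for x
    using abs[of x] vabs_pt_positive[OF that] that by (simp add: positive_def vabs_pt_def)
  have positive_upd: "positive (x(i := t))"
    if "positive x" "i \<in> I" "t \<in> carrier (E i)" "\<Zero>\<^bsub>E i\<^esub> \<sqsubseteq>\<^bsub>E i\<^esub> t" for x i t
    using that by (simp add: positive_def fun_upd_in_points)
  have mono: "\<phi> x \<le> \<phi> y"
    if x: "positive x" and y: "positive y" and le: "\<And>i. i \<in> I \<Longrightarrow> x i \<sqsubseteq>\<^bsub>E i\<^esub> y i" for x y
  proof -
    \<comment> \<open>The arguments of \<open>x\<close> are raised to those of \<open>y\<close> one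
      at a time, each time along a slice.\<close>
    have "positive (override_on x y J) \<and> \<phi> x \<le> \<phi> (override_on x y J)" if "J \<subseteq> I" for J
      using finite_subset[OF that I] that
    proof (induction J rule: finite_induct)
      case empty
      then show ?case using x by simp
    next
      case (insert k J)
      let ?w = "override_on x y J"
      have w: "positive ?w" "\<phi> x \<le> \<phi> ?w" and k: "k \<in> I" using insert by auto
      interpret Ek: riesz_space "E k" by (rule E[OF k])
      have c: "x k \<in> carrier (E k)" "y k \<in> carrier (E k)" "\<Zero>\<^bsub>E k\<^esub> \<sqsubseteq>\<^bsub>E k\<^esub> y k"
        using x y k by (auto simp: positive_def)
      have upd: "override_on x y (insert k J) = ?w(k := y k)"
        by (rule override_on_insert)
      have wk: "?w(k := x k) = ?w" using insert by (auto simp: override_on_def)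
      define s where "s = (\<lambda>t\<in>carrier (E k). 1 * \<phi> (?w(k := t)))"
      have s: "riesz_functional (E k) s" unfolding s_def using slice[OF w(1) k, of 1] by simp
      then have "s \<in> carrier (order_dual (E k))" by (simp add: riesz_functional_def)
      then have "s (x k) \<le> s (y k)"
        by (rule Ek.order_dual_mono) (use Ek.riesz_functional_nonneg[OF s] c le[OF k] in auto)
      then have "\<phi> ?w \<le> \<phi> (override_on x y (insert k J))"
        unfolding upd using c wk by (simp add: s_def)
      moreover have "positive (override_on x y (insert k J))"
        unfolding upd by (rule positive_upd[OF w(1) k c(2,3)])
      ultimately show ?case using w(2) by simp
    qed
    moreover have "override_on x y I = y"
      using x y by (intro extensionalityI[of _ I]) (auto simp: positive_def override_on_def PiE_iff extensional_def)
    ultimately show ?thesis by (metis order_refl)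
  qed
  obtain a where a: "positive a" "0 < \<phi> a"
  proof -
    obtain x where "x \<in> points I E" "\<phi> x \<noteq> 0" using True by blast
    then have "positive (vabs_pt x)" "0 < \<phi> (vabs_pt x)"
      using vabs_pt abs[of x] by (auto simp: vabs_pt_def)
    then show ?thesis by (rule that)
  qed
  have a_pt: "a \<in> points I E" "a i \<in> carrier (E i)" if "i \<in> I" for i
    using a that by (auto simp: positive_def)
  have aI: "a \<in> points I E" using a by (simp add: positive_def)

  have kernel: "\<phi> (y(i := t)) = 0"
    if i: "i \<in> I" and t: "t \<in> carrier (E i)" and 0: "\<phi> (a(i := t)) = 0" and y: "y \<in> points I E"
    for i t y
  proof -
    interpret Ei: riesz_space "E i" by (rule E[OF i])
    \<comment> \<open>A point above both \<open>a\<close> and the moduli of the arguments of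
      \<open>y\<close>. The slice through \<open>a\<close> is a multiple of the slice through
      \<open>b\<close>, so their null vectors can be compared, and the slice through
      \<open>b\<close> in turn controls the one through \<open>y\<close>.\<close>
    define b where "b = (\<lambda>j\<in>I. a j \<boxplus>\<^bsub>E j\<^esub> vabs (E j) (y j))"
    have b: "positive b" "a j \<sqsubseteq>\<^bsub>E j\<^esub> b j" "vabs (E j) (y j) \<sqsubseteq>\<^bsub>E j\<^esub> b j" if j: "j \<in> I" for j
    proof -
      have props: "b k \<in> carrier (E k) \<and> \<Zero>\<^bsub>E k\<^esub> \<sqsubseteq>\<^bsub>E k\<^esub> b k \<and> a k \<sqsubseteq>\<^bsub>E k\<^esub> b k \<and>
        vabs (E k) (y k) \<sqsubseteq>\<^bsub>E k\<^esub> b k" if k: "k \<in> I" for k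
      proof -
        interpret Ek: riesz_space "E k" by (rule E[OF k])
        have "a k \<in> carrier (E k)" "\<Zero>\<^bsub>E k\<^esub> \<sqsubseteq>\<^bsub>E k\<^esub> a k" "y k \<in> carrier (E k)"
          using a(1) y k by (auto simp: positive_def)
        then show ?thesis
          using k Ek.le_add_right[of "vabs (E k) (y k)" "a k"] Ek.le_add_right[of "a k" "vabs (E k) (y k)"]
            Ek.add_comm[of "a k" "vabs (E k) (y k)"] Ek.add_nonneg[of "a k" "vabs (E k) (y k)"]
          by (simp add: b_def)
      qed
      then have "b \<in> points I E" by (auto simp: b_def PiE_iff)
      then show "positive b" using props by (simp add: positive_def)
      show "a j \<sqsubseteq>\<^bsub>E j\<^esub> b j" "vabs (E j) (y j) \<sqsubseteq>\<^bsub>E j\<^esub> b j" using props[OF j] by auto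
    qed
    note bp = b(1)[OF i]
    let ?T = "\<lambda>x. \<lambda>t\<in>carrier (E i). 1 * \<phi> (x(i := t))"
    have le: "\<phi> (a(i := s)) \<le> \<phi> (b(i := s))" if "s \<in> carrier (E i)" "\<Zero>\<^bsub>E i\<^esub> \<sqsubseteq>\<^bsub>E i\<^esub> s" for s
      using b i that by (intro mono positive_upd a(1) bp) auto
    obtain c where c: "\<And>s. s \<in> carrier (E i) \<Longrightarrow> ?T a s = c * ?T b s"
    proof (rule Ei.dominated_by_riesz_functional[OF slice[OF bp i, of 1], of "?T a"])
      show "?T a \<in> carrier (order_dual (E i))"
        using slice[OF a(1) i, of 1] by (simp add: riesz_functional_def)
    qed (use le nonneg positive_upd[OF a(1) i] in auto)
    \<comment> \<open>At \<open>a i\<close> the slice through \<open>a\<close> has the value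
      \<open>\<phi> a\<close>, which is positive.\<close>
    have "c \<noteq> 0" using c[of "a i"] a(2) a_pt[OF i] by auto
    then have "\<phi> (b(i := t)) = 0" using c[OF t] 0 t by simp
    then have "\<phi> (b(i := vabs (E i) t)) = 0" using abs_upd[OF bp i t] by simp
    moreover have "\<bar>\<phi> (y(i := t))\<bar> \<le> \<phi> (b(i := vabs (E i) t))"
    proof -
      have yt: "y(i := t) \<in> points I E" using y i t by (rule fun_upd_in_points)
      have "\<phi> (vabs_pt (y(i := t))) \<le> \<phi> (b(i := vabs (E i) t))"
        using b i t by (intro mono vabs_pt yt positive_upd bp) (auto simp: vabs_pt_def)
      then show ?thesis using abs[OF yt] by (simp add: vabs_pt_def)
    qed
    ultimately show ?thesis by simp
  qed
  \<comment> \<open>Normalised to take the value 1 at \<open>a i\<close>, so that the whole scale of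
    the form is held by the constant \<open>\<phi> a\<close>.\<close>
  define h where "h i = (\<lambda>t\<in>carrier (E i). (1 / \<phi> a) * \<phi> (a(i := t)))" for i
  have factor: "\<phi> (y(i := t)) = h i t * \<phi> (y(i := a i))"
    if i: "i \<in> I" and t: "t \<in> carrier (E i)" and y: "y \<in> points I E" for i t y
  proof -
    interpret Ei: riesz_space "E i" by (rule E[OF i])
    \<comment> \<open>The correction makes \<open>?s\<close> a null vector of the slice through
      \<open>a\<close>; by \<open>kernel\<close> it is then null for every choice of the other
      arguments.\<close>
    let ?s = "t \<boxplus>\<^bsub>E i\<^esub> (- h i t) \<bullet>\<^bsub>E i\<^esub> a i"
    have upd: "\<phi> (x(i := ?s)) = \<phi> (x(i := t)) - h i t * \<phi> (x(i := a i))" if "x \<in> points I E" for x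
      using add[OF that i t, of "(- h i t) \<bullet>\<^bsub>E i\<^esub> a i"] scale[OF that i, of "a i" "- h i t"] a_pt[OF i] by simp
    have "\<phi> (a(i := ?s)) = 0"
      unfolding upd[OF aI] using a(2) t by (simp add: h_def)
    then have "\<phi> (y(i := ?s)) = 0"
      using a_pt[OF i] t by (intro kernel[OF i _ _ y]) simp_all
    then show ?thesis unfolding upd[OF y] by simp
  qed
  \<comment> \<open>Each argument of \<open>x\<close> is exchanged for that of \<open>a\<close> at
    the price of a factor \<open>h\<close>; for \<open>J = I\<close> only \<open>\<phi> a\<close> is
    left.\<close>
  have product: "\<phi> x = (\<Prod>i\<in>J. h i (x i)) * \<phi> (override_on x a J)"
    if x: "x \<in> points I E" and J: "J \<subseteq> I" for x J
    using finite_subset[OF J I] J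
  proof (induction J rule: finite_induct)
    case (insert k J)
    let ?w = "override_on x a J"
    have k: "k \<in> I" and xk: "x k \<in> carrier (E k)" using insert x by auto
    have w: "?w \<in> points I E"
      using x aI by (auto simp: override_on_def PiE_iff extensional_def)
    have wk: "?w(k := x k) = ?w" using insert by (auto simp: override_on_def)
    have upd: "override_on x a (insert k J) = ?w(k := a k)"
      by (rule override_on_insert)
    have "\<phi> ?w = h k (x k) * \<phi> (override_on x a (insert k J))"
      using factor[OF k xk w] unfolding upd wk .
    then show ?case using insert by (simp add: mult_ac del: override_on_insert)
  qed simp
  have "\<phi> x = \<phi> a * (\<Prod>i\<in>I. h i (x i))" if x: "x \<in> points I E" for x
  proof -
    have "override_on x a I = a"
      using x aI by (intro extensionalityI[of _ I]) (auto simp: override_on_def PiE_iff extensional_def)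
    then show ?thesis using product[OF x order_refl] by simp
  qed
  moreover have "riesz_functional (E i) (h i)" if "i \<in> I" for i
    unfolding h_def using a by (intro slice that) simp_all
  ultimately show ?thesis using a(2) by (intro exI[of _ "\<phi> a"] exI[of _ h]) simp
qed

section \<open>Arens extensions\<close>

context riesz_space
begin

text \<open>The whole carrier is one of the intersected subspaces, which keeps the hull inside
  it.\<close>

lemma riesz_subspace_hull:
  assumes "S \<subseteq> carrier E"
  shows "riesz_subspace E (riesz_subspace E hull S)"
proof -
  have "riesz_subspace E (carrier E)"
    by (simp add: riesz_subspace_def linear_subspace_def)
  then have "riesz_subspace E hull S \<subseteq> carrier E"
    using assms by (rule hull_minimal[rotated])
  then show ?thesis
    unfolding hull_def riesz_subspace_def linear_subspace_def by blast
qed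

lemma order_dual_lincomb:
  assumes "f \<in> carrier (order_dual E)" "finite U" "U \<subseteq> carrier E"
  shows "f (lincomb c U) = (\<Sum>u\<in>U. c u * f u)"
proof -
  have "f (lincomb c U) = (\<Sum>u\<in>U. f (c u \<bullet> u))"
    unfolding lincomb_def using assms by (intro additive_vsum) (auto simp: order_dual_add)
  also have "\<dots> = (\<Sum>u\<in>U. c u * f u)"
    using assms by (intro sum.cong) (auto simp: order_dual_scale)
  finally show ?thesis .
qed

lemma evaluation_add:
  "v \<in> carrier E \<Longrightarrow> w \<in> carrier E \<Longrightarrow>
    evaluation (v \<boxplus> w) = evaluation v \<boxplus>\<^bsub>order_bidual E\<^esub> evaluation w"
  by (simp add: evaluation_def add_order_dual[of "order_dual E"] order_dual_add fun_eq_iff)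

lemma evaluation_scale:
  "v \<in> carrier E \<Longrightarrow> evaluation (a \<bullet> v) = a \<bullet>\<^bsub>order_bidual E\<^esub> evaluation v"
  by (simp add: evaluation_def scale_order_dual[of "order_dual E"] order_dual_scale fun_eq_iff)

lemma evaluation_nonneg:
  assumes "v \<in> carrier E" "\<Zero> \<sqsubseteq> v"
  shows "\<Zero>\<^bsub>order_bidual E\<^esub> \<sqsubseteq>\<^bsub>order_bidual E\<^esub> evaluation v"
  using assms by (simp add: le_order_dual zero_order_dual evaluation_def)

text \<open>Restates linearity of \<open>z\<close> for pointwise sums, the form in which an Arens
  step presents its functional.\<close>

lemma bidual_sum:
  assumes z: "z \<in> carrier (order_bidual E)" and U: "finite U"
    and g: "\<And>u. u \<in> U \<Longrightarrow> g u \<in> carrier (order_dual E)"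
  shows "z (\<lambda>t\<in>carrier E. \<Sum>u\<in>U. e u * g u t) = (\<Sum>u\<in>U. e u * z (g u))"
proof -
  interpret D: riesz_space "order_dual E" by (rule riesz_space_order_dual)
  define r where "r V = (\<lambda>t\<in>carrier E. \<Sum>u\<in>V. e u * g u t)" for V
  have "r U \<in> carrier (order_dual E) \<and> z (r U) = (\<Sum>u\<in>U. e u * z (g u))"
    using U g
  proof (induction U rule: finite_induct)
    case empty
    have "r {} = \<Zero>\<^bsub>order_dual E\<^esub>" by (simp add: r_def zero_order_dual)
    then show ?case using D.order_dual_zero[OF z] D.zero_closed by simp
  next
    case (insert u U)
    have "r (insert u U) = (e u \<bullet>\<^bsub>order_dual E\<^esub> g u) \<boxplus>\<^bsub>order_dual E\<^esub> r U"
      using insert.hyps by (auto simp: r_def add_order_dual scale_order_dual fun_eq_iff)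
    then show ?case
      using insert z by (simp add: order_dual_add[of z] order_dual_scale[of z])
  qed
  then show ?thesis by (simp only: r_def)
qed

end

text \<open>Coordinates in a disjoint basis are unique, so additivity, homogeneity and, through
  \<open>vabs_lincomb\<close>, compatibility with absolute values pass from \<open>A\<close> to each
  coordinate, and \<open>real_multimorphism_product\<close> applies.\<close>

lemma finite_rank_multimorphism_decomposition:
  fixes E :: "nat \<Rightarrow> 'a riesz" and F :: "'b riesz" and A :: "(nat \<Rightarrow> 'a) \<Rightarrow> 'b"
  assumes I: "finite I" and E: "\<And>i. i \<in> I \<Longrightarrow> riesz_space (E i)"
    and F: "riesz_space F" and arch: "archimedean F"
    and A: "riesz_multimorphism I E F A" and fr: "finite_rank I E F A"
  obtains U \<kappa> h where "finite U" "riesz_space.disjoint_system F U" "\<And>u. u \<in> U \<Longrightarrow> 0 \<le> \<kappa> u"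
    "\<And>u i. u \<in> U \<Longrightarrow> i \<in> I \<Longrightarrow> riesz_functional (E i) (h u i)"
    "\<And>x. x \<in> points I E \<Longrightarrow> A x = riesz_space.lincomb F (\<lambda>u. \<kappa> u * (\<Prod>i\<in>I. h u i (x i))) U"
proof -
  interpret F: riesz_space F by (rule F)
  have AF: "A x \<in> carrier F" if "x \<in> points I E" for x
    using A that by (auto simp: riesz_multimorphism_def regular_multilinear_def multilinear_def)
  have Aadd: "A (x(i := u \<boxplus>\<^bsub>E i\<^esub> v)) = A (x(i := u)) \<boxplus>\<^bsub>F\<^esub> A (x(i := v))"
    if "x \<in> points I E" "i \<in> I" "u \<in> carrier (E i)" "v \<in> carrier (E i)" for x i u v
    using A that by (simp add: riesz_multimorphism_def regular_multilinear_def multilinear_def)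
  have Ascale: "A (x(i := a \<bullet>\<^bsub>E i\<^esub> u)) = a \<bullet>\<^bsub>F\<^esub> A (x(i := u))"
    if "x \<in> points I E" "i \<in> I" "u \<in> carrier (E i)" for x i a u
    using A that by (simp add: riesz_multimorphism_def regular_multilinear_def multilinear_def)
  have Aabs: "vabs F (A x) = A (\<lambda>i\<in>I. vabs (E i) (x i))" if "x \<in> points I E" for x
    using A that by (simp add: riesz_multimorphism_def)
  let ?G = "riesz_subspace F hull (A ` points I E)"
  have "riesz_subspace F ?G" using AF by (intro F.riesz_subspace_hull) auto
  moreover have "finite_dimensional F ?G" using fr by (simp add: finite_rank_def)
  ultimately obtain U where U: "finite U" "F.disjoint_system U"
    and span: "\<And>y. y \<in> ?G \<Longrightarrow> \<exists>c. y = F.lincomb c U"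
    using F.finite_dimensional_disjoint_basis[OF arch] by blast
  have UF: "U \<subseteq> carrier F" using U(2) by (simp add: F.disjoint_system_def)
  have "\<forall>x\<in>points I E. \<exists>c. A x = F.lincomb c U"
    using span by (blast intro: hull_inc)
  then obtain c where c: "\<And>x. x \<in> points I E \<Longrightarrow> A x = F.lincomb (c x) U"
    unfolding bchoice_iff by blast
  have "\<exists>\<kappa> h. 0 \<le> \<kappa> \<and> (\<forall>i\<in>I. riesz_functional (E i) (h i)) \<and>
    (\<forall>x\<in>points I E. c x u = \<kappa> * (\<Prod>i\<in>I. h i (x i)))" if u: "u \<in> U" for u
  proof (rule real_multimorphism_product[OF I E])
    fix x i a b assume x: "x \<in> points I E" and i: "i \<in> I" and ab: "a \<in> carrier (E i)" "b \<in> carrier (E i)"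
    interpret Ei: riesz_space "E i" by (rule E[OF i])
    have pts: "x(i := a) \<in> points I E" "x(i := b) \<in> points I E" "x(i := a \<boxplus>\<^bsub>E i\<^esub> b) \<in> points I E"
      using x i ab by (simp_all add: fun_upd_in_points)
    have "F.lincomb (c (x(i := a \<boxplus>\<^bsub>E i\<^esub> b))) U = F.lincomb (\<lambda>u. c (x(i := a)) u + c (x(i := b)) u) U"
      using Aadd[OF x i ab] by (simp add: c pts F.lincomb_add[OF U(1) UF])
    then show "c (x(i := a \<boxplus>\<^bsub>E i\<^esub> b)) u = c (x(i := a)) u + c (x(i := b)) u"
      using F.disjoint_system_unique[OF U _ u] by blast
  next
    fix x i s a assume x: "x \<in> points I E" and i: "i \<in> I" and a: "a \<in> carrier (E i)"
    interpret Ei: riesz_space "E i" by (rule E[OF i])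
    have pts: "x(i := a) \<in> points I E" "x(i := s \<bullet>\<^bsub>E i\<^esub> a) \<in> points I E"
      using x i a by (simp_all add: fun_upd_in_points)
    have "F.lincomb (c (x(i := s \<bullet>\<^bsub>E i\<^esub> a))) U = F.lincomb (\<lambda>u. s * c (x(i := a)) u) U"
      using Ascale[OF x i a, of s] by (simp add: c pts F.lincomb_scale[OF U(1) UF])
    then show "c (x(i := s \<bullet>\<^bsub>E i\<^esub> a)) u = s * c (x(i := a)) u"
      using F.disjoint_system_unique[OF U _ u] by blast
  next
    fix x assume x: "x \<in> points I E"
    have "(\<lambda>i\<in>I. vabs (E i) (x i)) \<in> points I E"
      using riesz_space.vabs_closed[OF E] points_carrier[OF x] by simp
    then have "F.lincomb (\<lambda>u. \<bar>c x u\<bar>) U = F.lincomb (c (\<lambda>i\<in>I. vabs (E i) (x i))) U"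
      using Aabs[OF x] by (simp add: c x F.vabs_lincomb[OF U])
    then show "\<bar>c x u\<bar> = c (\<lambda>i\<in>I. vabs (E i) (x i)) u"
      using F.disjoint_system_unique[OF U _ u] by blast
  qed
  then have "\<forall>u\<in>U. \<exists>\<kappa> h. 0 \<le> \<kappa> \<and> (\<forall>i\<in>I. riesz_functional (E i) (h i)) \<and>
    (\<forall>x\<in>points I E. c x u = \<kappa> * (\<Prod>i\<in>I. h i (x i)))" by blast
  from bchoice[OF this] obtain \<kappa> where "\<forall>u\<in>U. \<exists>h. 0 \<le> \<kappa> u \<and> (\<forall>i\<in>I. riesz_functional (E i) (h i)) \<and>
    (\<forall>x\<in>points I E. c x u = \<kappa> u * (\<Prod>i\<in>I. h i (x i)))"
    by blast
  from bchoice[OF this] obtain h where kh: "\<forall>u\<in>U. 0 \<le> \<kappa> u \<and> (\<forall>i\<in>I. riesz_functional (E i) (h u i)) \<and>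
    (\<forall>x\<in>points I E. c x u = \<kappa> u * (\<Prod>i\<in>I. h u i (x i)))"
    by blast
  show ?thesis
  proof (rule that[OF U, of \<kappa> h])
    fix x assume x: "x \<in> points I E"
    show "A x = F.lincomb (\<lambda>u. \<kappa> u * (\<Prod>i\<in>I. h u i (x i))) U"
      unfolding c[OF x] using kh x UF by (intro F.lincomb_cong) auto
  qed (use kh in auto)
qed

text \<open>With the other arguments fixed their factors are scalars, so \<open>z\<close> acts on a
  linear combination of the functionals \<open>h u j\<close>, and its values join the
  coefficients.\<close>

lemma arens_step_sum_of_products:
  assumes I: "finite I" "j \<in> I" and E: "riesz_space (E j)" and U: "finite U"
    and z: "z \<in> carrier (order_bidual (E j))"
    and h: "\<And>u. u \<in> U \<Longrightarrow> h u j \<in> carrier (order_dual (E j))"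
  shows "arens_step E I j z (\<lambda>x\<in>points I E. \<Sum>u\<in>U. d u * (\<Prod>i\<in>I. h u i (x i))) =
    (\<lambda>x\<in>points (I - {j}) E. \<Sum>u\<in>U. (d u * z (h u j)) * (\<Prod>i\<in>I - {j}. h u i (x i)))"
  unfolding arens_step_def
proof (rule restrict_ext)
  fix x assume x: "x \<in> points (I - {j}) E"
  have upd: "x(j := t) \<in> points I E" if "t \<in> carrier (E j)" for t
    using PiE_fun_upd[OF that x] I by (simp add: insert_absorb)
  have split: "(\<Prod>i\<in>I. h u i ((x(j := t)) i)) = h u j t * (\<Prod>i\<in>I - {j}. h u i (x i))" for u t
    using I by (simp add: prod.remove[of I j])
  have eq: "(\<lambda>t\<in>carrier (E j). (\<lambda>x\<in>points I E. \<Sum>u\<in>U. d u * (\<Prod>i\<in>I. h u i (x i))) (x(j := t))) =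
    (\<lambda>t\<in>carrier (E j). \<Sum>u\<in>U. (d u * (\<Prod>i\<in>I - {j}. h u i (x i))) * h u j t)"
    by (rule restrict_ext) (simp only: upd split restrict_apply', simp only: mult_ac)
  have sum: "z (\<lambda>t\<in>carrier (E j). \<Sum>u\<in>U. (d u * (\<Prod>i\<in>I - {j}. h u i (x i))) * h u j t) =
      (\<Sum>u\<in>U. (d u * (\<Prod>i\<in>I - {j}. h u i (x i))) * z (h u j))"
    by (rule riesz_space.bidual_sum[OF E z U h])
  show "z (\<lambda>t\<in>carrier (E j). (\<lambda>x\<in>points I E. \<Sum>u\<in>U. d u * (\<Prod>i\<in>I. h u i (x i))) (x(j := t))) =
      (\<Sum>u\<in>U. (d u * z (h u j)) * (\<Prod>i\<in>I - {j}. h u i (x i)))"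
    unfolding eq sum by (simp only: mult_ac)
qed

text \<open>The result involves the consumed indices only as a set; the order of consumption has
  disappeared. At \<open>k = m\<close> this set is the same for all permutations.\<close>

lemma arens_iter_sum_of_products:
  assumes \<rho>: "\<rho> permutes {1..m}" and E: "\<And>i. i \<in> {1..m} \<Longrightarrow> riesz_space (E i)" and U: "finite U"
    and z: "\<And>i. i \<in> {1..m} \<Longrightarrow> z i \<in> carrier (order_bidual (E i))"
    and h: "\<And>u i. u \<in> U \<Longrightarrow> i \<in> {1..m} \<Longrightarrow> h u i \<in> carrier (order_dual (E i))"
    and k: "k \<le> m"
  shows "arens_iter E m \<rho> z k (\<lambda>x\<in>points {1..m} E. \<Sum>u\<in>U. d u * (\<Prod>i\<in>{1..m}. h u i (x i))) =
    (\<lambda>x\<in>points ({1..m} - \<rho> ` {1..k}) E.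
      \<Sum>u\<in>U. (d u * (\<Prod>i\<in>\<rho> ` {1..k}. z i (h u i))) * (\<Prod>i\<in>{1..m} - \<rho> ` {1..k}. h u i (x i)))"
  using k
proof (induction k)
  case 0
  then show ?case by simp
next
  case (Suc k)
  let ?j = "\<rho> (Suc k)" and ?I = "{1..m} - \<rho> ` {1..k}"
  have "inj \<rho>" using \<rho> by (rule permutes_inj)
  then have jk: "?j \<notin> \<rho> ` {1..k}" by (simp add: inj_image_mem_iff)
  have jm: "?j \<in> {1..m}" using Suc.prems permutes_in_image[OF \<rho>] by simp
  have image: "\<rho> ` {1..Suc k} = insert ?j (\<rho> ` {1..k})" by (simp add: atLeastAtMostSuc_conv)
  have diff: "?I - {?j} = {1..m} - \<rho> ` {1..Suc k}" unfolding image by blast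
  have prod: "(\<Prod>i\<in>\<rho> ` {1..Suc k}. z i (h u i)) = z ?j (h u ?j) * (\<Prod>i\<in>\<rho> ` {1..k}. z i (h u i))" for u
    unfolding image using jk by simp
  have "arens_iter E m \<rho> z (Suc k) (\<lambda>x\<in>points {1..m} E. \<Sum>u\<in>U. d u * (\<Prod>i\<in>{1..m}. h u i (x i))) =
    (\<lambda>x\<in>points (?I - {?j}) E. \<Sum>u\<in>U. ((d u * (\<Prod>i\<in>\<rho> ` {1..k}. z i (h u i))) * z ?j (h u ?j)) *
      (\<Prod>i\<in>?I - {?j}. h u i (x i)))"
    unfolding arens_iter.simps Suc.IH[OF Suc_leD[OF Suc.prems]]
    using jk jm by (intro arens_step_sum_of_products E U z h) auto
  then show ?case unfolding diff prod by (simp only: mult_ac)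
qed

theorem theorem3p2:
  fixes m :: nat
    and E :: "nat \<Rightarrow> 'a riesz"
    and F :: "'b riesz"
    and A :: "(nat \<Rightarrow> 'a) \<Rightarrow> 'b"
  assumes "\<And>i. i \<in> {1..m} \<Longrightarrow> riesz_space (E i)"
    and "riesz_space F" and "archimedean F"
    and "riesz_multimorphism {1..m} E F A"
    and "finite_rank {1..m} E F A"
  shows "(\<forall>\<rho> \<sigma>. \<rho> permutes {1..m} \<longrightarrow> \<sigma> permutes {1..m} \<longrightarrow>
            arens_extension E F m \<rho> A = arens_extension E F m \<sigma> A) \<and>
         (\<forall>\<rho>. \<rho> permutes {1..m} \<longrightarrow>
            riesz_multimorphism {1..m} (\<lambda>i. order_bidual (E i)) (order_bidual F)
              (arens_extension E F m \<rho> A))"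
proof -
  let ?I = "{1..m}" and ?E'' = "\<lambda>i. order_bidual (E i)" and ?F'' = "order_bidual F"
  note E = assms(1)
  interpret F: riesz_space F by (rule assms(2))
  interpret F': riesz_space "order_dual F" by (rule F.riesz_space_order_dual)
  interpret F'': riesz_space ?F'' by (rule F'.riesz_space_order_dual)
  have E'': "riesz_space (?E'' i)" if "i \<in> ?I" for i
    by (intro riesz_space.riesz_space_order_dual E that)
  obtain U \<kappa> h where U: "finite U" "F.disjoint_system U" and \<kappa>: "\<And>u. u \<in> U \<Longrightarrow> 0 \<le> \<kappa> u"
    and h: "\<And>u i. u \<in> U \<Longrightarrow> i \<in> ?I \<Longrightarrow> riesz_functional (E i) (h u i)"
    and A: "\<And>x. x \<in> points ?I E \<Longrightarrow> A x = F.lincomb (\<lambda>u. \<kappa> u * (\<Prod>i\<in>?I. h u i (x i))) U"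
    using finite_rank_multimorphism_decomposition[OF finite_atLeastAtMost E assms(2-5)] by blast
  have UF: "U \<subseteq> carrier F" and Unonneg: "\<And>u. u \<in> U \<Longrightarrow> \<Zero>\<^bsub>F\<^esub> \<sqsubseteq>\<^bsub>F\<^esub> u"
    using U(2) by (auto simp: F.disjoint_system_def)
  have hD: "h u i \<in> carrier (order_dual (E i))" if "u \<in> U" "i \<in> ?I" for u i
    using h[OF that] by (simp add: riesz_functional_def)
  define C where "C z u = \<kappa> u * (\<Prod>i\<in>?I. z i (h u i))" for z u
  \<comment> \<open>The candidate makes no mention of a permutation. The restriction to the product
    makes the coincidence an equality of functions.\<close>
  define T where "T = (\<lambda>z\<in>points ?I ?E''. F.evaluation (F.lincomb (C z) U))"
  have TI: "T z = F.evaluation (F.lincomb (C z) U)" if "z \<in> points ?I ?E''" for z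
    using that by (simp add: T_def)

  have arens: "arens_extension E F m \<rho> A = T" if \<rho>: "\<rho> permutes ?I" for \<rho>
    unfolding arens_extension_def T_def F.evaluation_def
  proof (intro restrict_ext)
    fix z f assume z: "z \<in> points ?I ?E''" and f: "f \<in> carrier (order_dual F)"
    have "(\<lambda>x\<in>points ?I E. f (A x)) = (\<lambda>x\<in>points ?I E. \<Sum>u\<in>U. (\<kappa> u * f u) * (\<Prod>i\<in>?I. h u i (x i)))"
      by (rule restrict_ext) (simp add: A F.order_dual_lincomb[OF f U(1) UF] mult_ac)
    moreover have "arens_iter E m \<rho> z m
        (\<lambda>x\<in>points ?I E. \<Sum>u\<in>U. (\<kappa> u * f u) * (\<Prod>i\<in>?I. h u i (x i))) =
      (\<lambda>x\<in>points (?I - \<rho> ` ?I) E. \<Sum>u\<in>U. ((\<kappa> u * f u) * (\<Prod>i\<in>\<rho> ` ?I. z i (h u i))) *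
        (\<Prod>i\<in>?I - \<rho> ` ?I. h u i (x i)))"
      using points_carrier[OF z] by (intro arens_iter_sum_of_products \<rho> E U hD) auto
    \<comment> \<open>All indices are consumed: the remaining product over \<open>?I - ?I\<close> is
      1, and the only point left is \<open>\<lambda>_. undefined\<close>.\<close>
    ultimately have "arens_iter E m \<rho> z m (\<lambda>x\<in>points ?I E. f (A x)) (\<lambda>_. undefined) =
        (\<Sum>u\<in>U. (\<kappa> u * f u) * (\<Prod>i\<in>?I. z i (h u i)))"
      unfolding permutes_image[OF \<rho>] by simp
    then show "arens_iter E m \<rho> z m (\<lambda>x\<in>points ?I E. f (A x)) (\<lambda>_. undefined) = f (F.lincomb (C z) U)"
      by (simp add: F.order_dual_lincomb[OF f U(1) UF] C_def mult_ac)
  qed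

  \<comment> \<open>Isolates the factor of argument \<open>i\<close>, which makes linearity in that
    argument visible.\<close>
  have C_upd: "C (z(i := p)) u = p (h u i) * (\<kappa> u * (\<Prod>j\<in>?I - {i}. z j (h u j)))" if "i \<in> ?I" for z i p u
    using prod.remove[OF finite_atLeastAtMost that, of "\<lambda>j. (z(i := p)) j (h u j)"]
    by (simp add: C_def)
  have lin: "F.lincomb c U \<in> carrier F" for c using UF by simp
  have "multilinear ?I ?E'' ?F'' T"
    unfolding multilinear_def
  proof (intro conjI ballI allI)
    show "T \<in> points ?I ?E'' \<rightarrow> carrier ?F''"
      by (simp add: TI F.evaluation_closed lin)
  next
    fix z i p q assume z: "z \<in> points ?I ?E''" and i: "i \<in> ?I"
      and p: "p \<in> carrier (?E'' i)" and q: "q \<in> carrier (?E'' i)"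
    interpret Ei: riesz_space "?E'' i" by (rule E''[OF i])
    have "F.lincomb (C (z(i := p \<boxplus>\<^bsub>?E'' i\<^esub> q))) U = F.lincomb (\<lambda>u. C (z(i := p)) u + C (z(i := q)) u) U"
      using i hD UF by (intro F.lincomb_cong) (simp_all add: C_upd add_order_dual algebra_simps)
    also have "\<dots> = F.lincomb (C (z(i := p))) U \<boxplus>\<^bsub>F\<^esub> F.lincomb (C (z(i := q))) U"
      using F.lincomb_add[OF U(1) UF] by simp
    finally show "T (z(i := p \<boxplus>\<^bsub>?E'' i\<^esub> q)) = T (z(i := p)) \<boxplus>\<^bsub>?F''\<^esub> T (z(i := q))"
      using z i p q by (simp add: TI fun_upd_in_points F.evaluation_add lin)
  next
    fix z i a p assume z: "z \<in> points ?I ?E''" and i: "i \<in> ?I" and p: "p \<in> carrier (?E'' i)"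
    interpret Ei: riesz_space "?E'' i" by (rule E''[OF i])
    have "F.lincomb (C (z(i := a \<bullet>\<^bsub>?E'' i\<^esub> p))) U = F.lincomb (\<lambda>u. a * C (z(i := p)) u) U"
      using i hD UF by (intro F.lincomb_cong) (simp_all add: C_upd scale_order_dual algebra_simps)
    also have "\<dots> = a \<bullet>\<^bsub>F\<^esub> F.lincomb (C (z(i := p))) U"
      using F.lincomb_scale[OF U(1) UF] by simp
    finally show "T (z(i := a \<bullet>\<^bsub>?E'' i\<^esub> p)) = a \<bullet>\<^bsub>?F''\<^esub> T (z(i := p))"
      using z i p by (simp add: TI fun_upd_in_points F.evaluation_scale lin)
  qed
  moreover have "\<Zero>\<^bsub>?F''\<^esub> \<sqsubseteq>\<^bsub>?F''\<^esub> T z"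
    if z: "z \<in> points ?I ?E''" and pos: "\<forall>i\<in>?I. \<Zero>\<^bsub>?E'' i\<^esub> \<sqsubseteq>\<^bsub>?E'' i\<^esub> z i" for z
  proof -
    have "0 \<le> z i (h u i)" if "u \<in> U" "i \<in> ?I" for u i
    proof -
      have "\<Zero>\<^bsub>order_dual (E i)\<^esub> \<sqsubseteq>\<^bsub>order_dual (E i)\<^esub> h u i"
        using riesz_space.riesz_functional_nonneg[OF E h] that
        by (simp add: le_order_dual zero_order_dual)
      moreover have "\<Zero>\<^bsub>?E'' i\<^esub> \<sqsubseteq>\<^bsub>?E'' i\<^esub> z i" using pos that by blast
      ultimately show ?thesis
        using hD[OF that]
        by (simp add: le_order_dual[of "order_dual (E i)"] zero_order_dual[of "order_dual (E i)"])
    qed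
    then have "\<Zero>\<^bsub>F\<^esub> \<sqsubseteq>\<^bsub>F\<^esub> F.lincomb (C z) U"
      unfolding F.lincomb_def using U UF Unonneg \<kappa>
      by (intro F.vsum_nonneg F.scale_nonneg F.scale_closed) (auto simp: C_def intro!: mult_nonneg_nonneg prod_nonneg)
    then show ?thesis using z by (simp add: TI F.evaluation_nonneg lin)
  qed
  ultimately have "positive_multilinear ?I ?E'' ?F'' T"
    by (simp add: positive_multilinear_def)
  \<comment> \<open>\<open>T\<close> is itself positive, so regularity is witnessed with zero as the
    subtrahend.\<close>
  moreover have "positive_multilinear ?I ?E'' ?F'' (\<lambda>_. \<Zero>\<^bsub>?F''\<^esub>)"
    by (simp add: positive_multilinear_def multilinear_def)
  moreover have "T z = T z \<boxplus>\<^bsub>?F''\<^esub> (-1) \<bullet>\<^bsub>?F''\<^esub> \<Zero>\<^bsub>?F''\<^esub>" if "z \<in> points ?I ?E''" for z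
    using that by (simp add: TI F.evaluation_closed lin)
  ultimately have "regular_multilinear ?I ?E'' ?F'' T"
    unfolding regular_multilinear_def positive_multilinear_def by blast
  moreover have "vabs ?F'' (T z) = T (\<lambda>i\<in>?I. vabs (?E'' i) (z i))" if z: "z \<in> points ?I ?E''" for z
  proof -
    let ?z = "\<lambda>i\<in>?I. vabs (?E'' i) (z i)"
    have zc: "?z \<in> points ?I ?E''"
      using riesz_space.vabs_closed[OF E''] points_carrier[OF z] by simp
    \<comment> \<open>\<open>C\<close> evaluates bidual elements only at Riesz functionals, where
      \<open>vabs_bidual_riesz_functional\<close> applies; the modulus passes over
      \<open>\<kappa> u\<close> because it is nonnegative.\<close>
    have "\<bar>C z u\<bar> = C ?z u" if u: "u \<in> U" for u
    proof -
      have "(\<Prod>i\<in>?I. \<bar>z i (h u i)\<bar>) = (\<Prod>i\<in>?I. ?z i (h u i))"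
        using riesz_space.vabs_bidual_riesz_functional[OF E points_carrier[OF z] h[OF u]]
        by (intro prod.cong) simp_all
      then show ?thesis using \<kappa>[OF u] by (simp add: C_def abs_mult abs_prod)
    qed
    then have "F.lincomb (\<lambda>u. \<bar>C z u\<bar>) U = F.lincomb (C ?z) U"
      using UF by (intro F.lincomb_cong)
    then show ?thesis
      using z zc by (simp add: TI F.vabs_evaluation lin F.vabs_lincomb[OF U])
  qed
  ultimately have "riesz_multimorphism ?I ?E'' ?F'' T"
    by (simp add: riesz_multimorphism_def)
  then show ?thesis using arens by simp
qed

end
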